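(* Let $d \geq 5$ with $d \neq 7$, let $H_d = \langle a,b,c \mid a^2,b^2,c^2,(ab)^3,(ac)^2,(bc)^d,(bac)^d\rangle$, and let $V \leq H_d$. Then $(H_d/V, a, b, c)$ is a geodesic self-dual degree-$d$-surface if and only if (1) $g^{-1}Vg \cap X = \{1\}$ for all $g \in H_d$ and all $X \in \{\langle a\rangle, \langle c\rangle, \langle ab\rangle, \langle ac\rangle, \langle bc\rangle\}$, and (2) $V^{\#}$ is conjugate to $V$ in $H_d$. Furthermore, every geodesic self-dual degree-$d$-surface is isomorphic to one of this form.
   Context: A surface is a quadruple $(\mathcal{F},\alpha,\beta,\gamma)$ where $\mathcal{F}$ is a set (of flags) and $\alpha,\beta,\gamma$ are permutations of $\mathcal{F}$ such that: $\alpha,\beta,\gamma$ are involutions without fixed points; $\langle\alpha,\beta,\gamma\rangle$ acts transitively on $\mathcal{F}$; $\alpha\beta$ consists only of 3-cycles; $\alpha\gamma$ consists only of 2-cycles. It is a degree-$d$-surface ($d\ge 3$) if moreover $\beta\gamma$ consists only of $d$-cycles. Its geodesic dual is the surface $(\mathcal{F},\alpha,\beta,\alpha\gamma)$. An isomorphism $(\mathcal{F},\alpha,\beta,\gamma)\to(\mathcal{G},\rho,\sigma,\tau)$ is a bijection $\phi:\mathcal{F}\to\mathcal{G}$ with $\phi^{-1}\alpha\phi=\rho$, $\phi^{-1}\beta\phi=\sigma$, $\phi^{-1}\gamma\phi=\tau$. A surface is geodesic self-dual if it is isomorphic to its geodesic dual. For a group $G$ generated by $a,b,c$ and $V\le G$,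 $(G/V,a,b,c)$ denotes the quadruple whose flags are the left cosets $hV$ and whose three permutations are left multiplication by $a$, $b$, $c$ respectively. $\#: H_d\to H_d$ is the automorphism determined by $a\mapsto a$, $b\mapsto b$, $c\mapsto ac$, and $V^{\#}=\{\#(g): g\in V\}$. *)

theory Defs
  imports
    "HOL-Algebra.Group_Action"
    "HOL-Algebra.Left_Coset"
    "HOL-Algebra.Generated_Groups"
    "HOL-Combinatorics.Orbits"
begin

section \<open>Surfaces given by flags and three permutations\<close>

text \<open>Permutations of \<open>F\<close> are the elements of \<^term>\<open>Bij F\<close>; being extensional, they carry
  no information outside \<open>F\<close>.\<close>

type_synonym 'f quadruple = "'f set \<times> ('f \<Rightarrow> 'f) \<times> ('f \<Rightarrow> 'f) \<times> ('f \<Rightarrow> 'f)"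

definition fixed_point_free_involution :: "'f set \<Rightarrow> ('f \<Rightarrow> 'f) \<Rightarrow> bool" where
  "fixed_point_free_involution F \<pi> \<longleftrightarrow>
     \<pi> \<in> Bij F \<and> (\<forall>x\<in>F. \<pi> (\<pi> x) = x) \<and> (\<forall>x\<in>F. \<pi> x \<noteq> x)"

text \<open>For a permutation \<open>\<pi>\<close> of \<open>F\<close> whose cycle through \<open>x\<close> is finite, \<^term>\<open>Orbits.orbit \<pi> x\<close>
  is the support of that cycle. An infinite orbit has cardinality \<open>0\<close>, so for \<open>n > 0\<close> it is
  excluded.\<close>

definition only_cycles_of_length :: "'f set \<Rightarrow> ('f \<Rightarrow> 'f) \<Rightarrow> nat \<Rightarrow> bool" where
  "only_cycles_of_length F \<pi> n \<longleftrightarrow> (\<forall>x\<in>F. card (Orbits.orbit \<pi> x) = n)"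

text \<open>\<^const>\<open>transitive_action\<close> holds vacuously on the empty set; a transitive action is understood
  to have exactly one orbit, hence \<open>F \<noteq> {}\<close>.\<close>

fun surface :: "'f quadruple \<Rightarrow> bool" where
  "surface (F, \<alpha>, \<beta>, \<gamma>) \<longleftrightarrow>
     fixed_point_free_involution F \<alpha> \<and>
     fixed_point_free_involution F \<beta> \<and>
     fixed_point_free_involution F \<gamma> \<and>
     F \<noteq> {} \<and>
     transitive_action (subgroup_generated (BijGroup F) {\<alpha>, \<beta>, \<gamma>}) F (\<lambda>g. g) \<and>
     only_cycles_of_length F (compose F \<alpha> \<beta>) 3 \<and>
     only_cycles_of_length F (compose F \<alpha> \<gamma>) 2"

fun degree_surface :: "nat \<Rightarrow> 'f quadruple \<Rightarrow> bool" where
  "degree_surface d (F, \<alpha>, \<beta>, \<gamma>) \<longleftrightarrow>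
     3 \<le> d \<and> surface (F, \<alpha>, \<beta>, \<gamma>) \<and> only_cycles_of_length F (compose F \<beta> \<gamma>) d"

fun geodesic_dual :: "'f quadruple \<Rightarrow> 'f quadruple" where
  "geodesic_dual (F, \<alpha>, \<beta>, \<gamma>) = (F, \<alpha>, \<beta>, compose F \<alpha> \<gamma>)"

text \<open>The condition \<open>\<phi>\<^sup>-\<^sup>1 \<alpha> \<phi> = \<rho>\<close> is an equation between permutations of \<open>G\<close>, so its
  left-hand side is read as: first \<open>\<phi>\<^sup>-\<^sup>1 : G \<rightarrow> F\<close>, then \<open>\<alpha>\<close>, then \<open>\<phi>\<close>.\<close>

fun surface_isomorphic :: "'f quadruple \<Rightarrow> 'g quadruple \<Rightarrow> bool" where
  "surface_isomorphic (F, \<alpha>, \<beta>, \<gamma>) (G, \<rho>, \<sigma>, \<tau>) \<longleftrightarrow>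
     (\<exists>\<phi>. bij_betw \<phi> F G \<and>
        (\<forall>y\<in>G. \<phi> (\<alpha> (inv_into F \<phi> y)) = \<rho> y) \<and>
        (\<forall>y\<in>G. \<phi> (\<beta> (inv_into F \<phi> y)) = \<sigma> y) \<and>
        (\<forall>y\<in>G. \<phi> (\<gamma> (inv_into F \<phi> y)) = \<tau> y))"

definition geodesic_self_dual :: "'f quadruple \<Rightarrow> bool" where
  "geodesic_self_dual S \<longleftrightarrow> surface_isomorphic S (geodesic_dual S)"

definition coset_quadruple ::
    "('g, 'm) monoid_scheme \<Rightarrow> 'g set \<Rightarrow> 'g \<Rightarrow> 'g \<Rightarrow> 'g \<Rightarrow> 'g set quadruple" where
  "coset_quadruple G V a b c =
     (lcosets\<^bsub>G\<^esub> V,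
      \<lambda>C\<in>lcosets\<^bsub>G\<^esub> V. a <#\<^bsub>G\<^esub> C,
      \<lambda>C\<in>lcosets\<^bsub>G\<^esub> V. b <#\<^bsub>G\<^esub> C,
      \<lambda>C\<in>lcosets\<^bsub>G\<^esub> V. c <#\<^bsub>G\<^esub> C)"


section \<open>Groups given by generators and relators\<close>

text \<open>A letter \<open>(True, x)\<close> stands for the generator \<open>x\<close> and \<open>(False, x)\<close> for its formal inverse.\<close>

type_synonym 'x word = "(bool \<times> 'x) list"

inductive word_cong :: "'x word set \<Rightarrow> 'x word \<Rightarrow> 'x word \<Rightarrow> bool" for R where
  refl: "word_cong R u u"
| sym: "word_cong R u v \<Longrightarrow> word_cong R v u"
| trans: "word_cong R u v \<Longrightarrow> word_cong R v w \<Longrightarrow> word_cong R u w"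
| cancel: "word_cong R (u @ [(s, x), (\<not> s, x)] @ v) (u @ v)"
| relator: "r \<in> R \<Longrightarrow> word_cong R (u @ r @ v) (u @ v)"

definition word_class :: "'x word set \<Rightarrow> 'x word \<Rightarrow> 'x word set" where
  "word_class R w = {v. word_cong R w v}"

definition presented_group :: "'x word set \<Rightarrow> 'x word set monoid" where
  "presented_group R =
     \<lparr>carrier = range (word_class R),
      monoid.mult = \<lambda>P Q. \<Union>u\<in>P. \<Union>v\<in>Q. word_class R (u @ v),
      one = word_class R []\<rparr>"

lemma word_class_eq_iff: "word_class R u = word_class R v \<longleftrightarrow> word_cong R u v"
proof
  assume "word_class R u = word_class R v"
  moreover have "v \<in> word_class R v" by (simp add: word_class_def word_cong.refl)
  ultimately show "word_cong R u v" by (auto simp: word_class_def)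
next
  assume uv: "word_cong R u v"
  have "word_cong R u w \<longleftrightarrow> word_cong R v w" for w
    using word_cong.trans[OF uv, of w] word_cong.trans[OF word_cong.sym[OF uv], of w] by blast
  then show "word_class R u = word_class R v"
    by (simp add: word_class_def)
qed

lemma word_cong_append_left: "word_cong R u v \<Longrightarrow> word_cong R (w @ u) (w @ v)"
proof (induction rule: word_cong.induct)
  case (cancel u s x v)
  show ?case using word_cong.cancel[of R "w @ u" s x v] by simp
next
  case (relator r u v)
  then show ?case using word_cong.relator[of r R "w @ u" v] by simp
next
  case (trans u v z)
  show ?case by (rule word_cong.trans[OF trans.IH])
qed (simp_all add: word_cong.refl word_cong.sym)

lemma word_cong_append_right: "word_cong R u v \<Longrightarrow> word_cong R (u @ w) (v @ w)"
proof (induction rule: word_cong.induct)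
  case (cancel u s x v)
  show ?case using word_cong.cancel[of R u s x "v @ w"] by simp
next
  case (relator r u v)
  then show ?case using word_cong.relator[of r R u "v @ w"] by simp
next
  case (trans u v z)
  show ?case by (rule word_cong.trans[OF trans.IH])
qed (simp_all add: word_cong.refl word_cong.sym)

lemma presented_group_mult:
  "word_class R u \<otimes>\<^bsub>presented_group R\<^esub> word_class R v = word_class R (u @ v)"
proof -
  have "word_class R (u' @ v') = word_class R (u @ v)"
    if "u' \<in> word_class R u" "v' \<in> word_class R v" for u' v'
  proof -
    have "word_cong R u u'" "word_cong R v v'"
      using that by (auto simp: word_class_def)
    then have "word_cong R (u @ v) (u' @ v')"
      by (rule word_cong.trans[OF word_cong_append_right word_cong_append_left])
    then show ?thesis by (simp add: word_class_eq_iff word_cong.sym)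
  qed
  moreover have "u \<in> word_class R u" "v \<in> word_class R v"
    by (auto simp: word_class_def word_cong.refl)
  ultimately show ?thesis
    unfolding presented_group_def monoid.simps by blast
qed

lemma presented_group_one: "\<one>\<^bsub>presented_group R\<^esub> = word_class R []"
  by (simp add: presented_group_def)

lemma presented_group_carrier: "carrier (presented_group R) = range (word_class R)"
  by (simp add: presented_group_def)

definition inv_word :: "'x word \<Rightarrow> 'x word" where
  "inv_word w = rev (map (\<lambda>(s, x). (\<not> s, x)) w)"

lemma word_cong_inv_word: "word_cong R (inv_word w @ w) []"
proof (induction w)
  case Nil
  show ?case by (simp add: inv_word_def word_cong.refl)
next
  case (Cons l w)
  obtain s x where l: "l = (s, x)" by (cases l)
  have "word_cong R (inv_word (l # w) @ l # w) (inv_word w @ w)"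
    using word_cong.cancel[of R "inv_word w" "\<not> s" x w] by (simp add: inv_word_def l)
  then show ?case using Cons.IH word_cong.trans by blast
qed

lemma group_presented_group: "group (presented_group R)"
proof (rule groupI)
  fix P assume "P \<in> carrier (presented_group R)"
  then obtain w where P: "P = word_class R w"
    by (auto simp: presented_group_carrier)
  have "word_class R (inv_word w) \<otimes>\<^bsub>presented_group R\<^esub> P = \<one>\<^bsub>presented_group R\<^esub>"
    by (simp add: P presented_group_mult presented_group_one word_class_eq_iff word_cong_inv_word)
  then show "\<exists>Q\<in>carrier (presented_group R). Q \<otimes>\<^bsub>presented_group R\<^esub> P = \<one>\<^bsub>presented_group R\<^esub>"
    by (auto simp: presented_group_carrier)
qed (auto simp: presented_group_carrier presented_group_mult presented_group_one)

fun eval_word :: "('k, 'm) monoid_scheme \<Rightarrow> ('x \<Rightarrow> 'k) \<Rightarrow> 'x word \<Rightarrow> 'k" where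
  "eval_word K f [] = \<one>\<^bsub>K\<^esub>"
| "eval_word K f ((s, x) # w) = (if s then f x else inv\<^bsub>K\<^esub> f x) \<otimes>\<^bsub>K\<^esub> eval_word K f w"

context group
begin

lemma eval_word_closed: "range f \<subseteq> carrier G \<Longrightarrow> eval_word G f w \<in> carrier G"
  by (induction w) (auto simp: image_subset_iff)

lemma eval_word_append:
  assumes "range f \<subseteq> carrier G"
  shows "eval_word G f (u @ v) = eval_word G f u \<otimes> eval_word G f v"
proof (induction u)
  case (Cons l u)
  then show ?case
    using assms eval_word_closed[OF assms] by (cases l) (auto simp: m_assoc image_subset_iff)
qed (simp add: eval_word_closed[OF assms])

lemma eval_word_cong:
  assumes f: "range f \<subseteq> carrier G" and R: "\<And>r. r \<in> R \<Longrightarrow> eval_word G f r = \<one>"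
  shows "word_cong R u v \<Longrightarrow> eval_word G f u = eval_word G f v"
proof (induction rule: word_cong.induct)
  case (cancel u s x v)
  have "f x \<in> carrier G" using f by auto
  then have "eval_word G f [(s, x), (\<not> s, x)] = \<one>" by auto
  then show ?case
    by (simp only: eval_word_append[OF f]) (simp add: eval_word_closed[OF f])
next
  case (relator r u v)
  then show ?case by (simp add: eval_word_append[OF f] eval_word_closed[OF f] R)
qed auto

lemma presented_group_universal:
  assumes f: "range f \<subseteq> carrier G" and R: "\<And>r. r \<in> R \<Longrightarrow> eval_word G f r = \<one>"
  obtains h where "h \<in> hom (presented_group R) G"
    and "\<And>w. h (word_class R w) = eval_word G f w"
proof -
  define h where "h P = eval_word G f (SOME w. P = word_class R w)" for P
  have h: "h (word_class R w) = eval_word G f w" for w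
  proof -
    have "word_class R w = word_class R (SOME v. word_class R w = word_class R v)"
      by (rule someI[of "\<lambda>v. word_class R w = word_class R v" w]) simp
    then show ?thesis
      unfolding h_def using eval_word_cong[OF f R] by (metis word_class_eq_iff)
  qed
  have "h \<in> hom (presented_group R) G"
    by (rule homI)
       (auto simp: presented_group_carrier presented_group_mult h eval_word_closed[OF f]
          eval_word_append[OF f])
  then show ?thesis using that h by blast
qed

end


section \<open>The group \<open>H\<^sub>d\<close>\<close>

datatype gen = Gen_a | Gen_b | Gen_c

definition gen_word :: "gen list \<Rightarrow> gen word" where
  "gen_word xs = map (Pair True) xs"

definition word_pow :: "gen list \<Rightarrow> nat \<Rightarrow> gen word" where
  "word_pow xs n = concat (replicate n (gen_word xs))"

definition relators :: "nat \<Rightarrow> gen word set" where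
  "relators d =
     {word_pow [Gen_a] 2, word_pow [Gen_b] 2, word_pow [Gen_c] 2,
      word_pow [Gen_a, Gen_b] 3, word_pow [Gen_a, Gen_c] 2,
      word_pow [Gen_b, Gen_c] d, word_pow [Gen_b, Gen_a, Gen_c] d}"

definition Hgrp :: "nat \<Rightarrow> gen word set monoid" where
  "Hgrp d = presented_group (relators d)"

definition gen_a :: "nat \<Rightarrow> gen word set" where
  "gen_a d = word_class (relators d) [(True, Gen_a)]"

definition gen_b :: "nat \<Rightarrow> gen word set" where
  "gen_b d = word_class (relators d) [(True, Gen_b)]"

definition gen_c :: "nat \<Rightarrow> gen word set" where
  "gen_c d = word_class (relators d) [(True, Gen_c)]"

text \<open>Elements of \<^term>\<open>auto G\<close> are extensional, so the automorphism is unique as a function;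
  existence and uniqueness are shown in \<open>sharp_ex1\<close> below.\<close>

definition sharp :: "nat \<Rightarrow> gen word set \<Rightarrow> gen word set" where
  "sharp d = (THE f. f \<in> auto (Hgrp d) \<and> f (gen_a d) = gen_a d \<and> f (gen_b d) = gen_b d \<and>
     f (gen_c d) = gen_a d \<otimes>\<^bsub>Hgrp d\<^esub> gen_c d)"

lemma group_H: "group (Hgrp d)"
  by (simp add: Hgrp_def group_presented_group)

lemma gens_in_carrier:
  "gen_a d \<in> carrier (Hgrp d)" "gen_b d \<in> carrier (Hgrp d)" "gen_c d \<in> carrier (Hgrp d)"
  by (auto simp: Hgrp_def gen_a_def gen_b_def gen_c_def presented_group_carrier)

primrec gen_class :: "nat \<Rightarrow> gen \<Rightarrow> gen word set" where
  "gen_class d Gen_a = gen_a d"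
| "gen_class d Gen_b = gen_b d"
| "gen_class d Gen_c = gen_c d"

lemma gen_class_eq: "gen_class d x = word_class (relators d) [(True, x)]"
  by (cases x) (auto simp: gen_a_def gen_b_def gen_c_def)

lemma gen_class_closed: "gen_class d x \<in> carrier (Hgrp d)"
  by (cases x) (auto simp: gens_in_carrier)

lemma eval_word_gen_class: "eval_word (Hgrp d) (gen_class d) w = word_class (relators d) w"
proof (induction w)
  case Nil
  show ?case by (simp add: Hgrp_def presented_group_one)
next
  case (Cons l w)
  obtain s x where l: "l = (s, x)" by (cases l)
  interpret group "Hgrp d" by (rule group_H)
  have "word_class (relators d) [(False, x)] \<otimes>\<^bsub>Hgrp d\<^esub> gen_class d x = \<one>\<^bsub>Hgrp d\<^esub>"
    using word_cong.cancel[of "relators d" "[]" False x "[]"]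
    by (simp add: gen_class_eq Hgrp_def presented_group_mult presented_group_one word_class_eq_iff)
  then have "inv\<^bsub>Hgrp d\<^esub> gen_class d x = word_class (relators d) [(False, x)]"
    by (rule inv_equality) (auto simp: gen_class_closed, simp add: Hgrp_def presented_group_carrier)
  then show ?case
    using presented_group_mult[of "relators d" "[l]" w, folded Hgrp_def]
    by (cases s) (simp_all add: l Cons.IH gen_class_eq[of d x])
qed

lemma hom_H_eqI:
  assumes K: "group K" and h: "h \<in> hom (Hgrp d) K" and k: "k \<in> hom (Hgrp d) K"
    and eq: "\<And>x. h (gen_class d x) = k (gen_class d x)" and g: "g \<in> carrier (Hgrp d)"
  shows "h g = k g"
proof -
  interpret h: group_hom "Hgrp d" K h
    by (intro group_hom.intro group_hom_axioms.intro group_H K h)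
  interpret k: group_hom "Hgrp d" K k
    by (intro group_hom.intro group_hom_axioms.intro group_H K k)
  have closed: "eval_word (Hgrp d) (gen_class d) w \<in> carrier (Hgrp d)" for w
    by (simp add: eval_word_gen_class) (simp add: Hgrp_def presented_group_carrier)
  have "h (eval_word (Hgrp d) (gen_class d) w) = k (eval_word (Hgrp d) (gen_class d) w)" for w
  proof (induction w)
    case (Cons l w)
    then show ?case
      by (cases l) (auto simp: gen_class_closed closed eq)
  qed simp
  moreover obtain w where "g = word_class (relators d) w"
    using g by (auto simp: Hgrp_def presented_group_carrier)
  ultimately show ?thesis by (simp add: eval_word_gen_class)
qed

lemma eval_word_pow:
  assumes "group K" "range f \<subseteq> carrier K"
  shows "eval_word K f (word_pow xs n) = eval_word K f (gen_word xs) [^]\<^bsub>K\<^esub> n"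
proof -
  interpret group K by fact
  show ?thesis
  proof (induction n)
    case (Suc n)
    then show ?case
      using nat_pow_Suc2[OF eval_word_closed[OF assms(2), of "gen_word xs"], of n]
      by (simp add: word_pow_def eval_word_append[OF assms(2)])
  qed (simp add: word_pow_def)
qed

lemma H_relator:
  assumes "word_pow xs n \<in> relators d"
  shows "eval_word (Hgrp d) (gen_class d) (gen_word xs) [^]\<^bsub>Hgrp d\<^esub> n = \<one>\<^bsub>Hgrp d\<^esub>"
proof -
  have "word_cong (relators d) (word_pow xs n) []"
    using word_cong.relator[OF assms, of "[]" "[]"] by simp
  then have "eval_word (Hgrp d) (gen_class d) (word_pow xs n) = \<one>\<^bsub>Hgrp d\<^esub>"
    by (simp add: eval_word_gen_class word_class_eq_iff) 
       (simp add: Hgrp_def presented_group_one word_class_eq_iff)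
  then show ?thesis
    using eval_word_pow[OF group_H, of "gen_class d" d xs n] gen_class_closed by auto
qed

lemma sharp_ex1:
  "\<exists>!f. f \<in> auto (Hgrp d) \<and> f (gen_a d) = gen_a d \<and> f (gen_b d) = gen_b d \<and>
     f (gen_c d) = gen_a d \<otimes>\<^bsub>Hgrp d\<^esub> gen_c d"
proof (rule ex_ex1I)
  interpret group "Hgrp d" by (rule group_H)
  note [simp] = gens_in_carrier[of d]
  let ?a = "gen_a d" and ?b = "gen_b d" and ?c = "gen_c d"
  define f where "f x = (case x of Gen_a \<Rightarrow> ?a | Gen_b \<Rightarrow> ?b | Gen_c \<Rightarrow> ?a \<otimes>\<^bsub>Hgrp d\<^esub> ?c)" for x
  have f: "range f \<subseteq> carrier (Hgrp d)" by (auto simp: f_def split: gen.splits)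
  have aa: "?a \<otimes>\<^bsub>Hgrp d\<^esub> ?a = \<one>\<^bsub>Hgrp d\<^esub>" and bb: "?b \<otimes>\<^bsub>Hgrp d\<^esub> ?b = \<one>\<^bsub>Hgrp d\<^esub>" and cc: "?c \<otimes>\<^bsub>Hgrp d\<^esub> ?c = \<one>\<^bsub>Hgrp d\<^esub>"
    using H_relator[of "[Gen_a]" 2 d] H_relator[of "[Gen_b]" 2 d] H_relator[of "[Gen_c]" 2 d]
    by (auto simp: relators_def gen_word_def numeral_2_eq_2)
  have ab: "(?a \<otimes>\<^bsub>Hgrp d\<^esub> ?b) [^]\<^bsub>Hgrp d\<^esub> (3::nat) = \<one>\<^bsub>Hgrp d\<^esub>"
    using H_relator[of "[Gen_a, Gen_b]" 3 d] by (auto simp: relators_def gen_word_def)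
  have ac: "(?a \<otimes>\<^bsub>Hgrp d\<^esub> ?c) [^]\<^bsub>Hgrp d\<^esub> (2::nat) = \<one>\<^bsub>Hgrp d\<^esub>"
    using H_relator[of "[Gen_a, Gen_c]" 2 d] by (auto simp: relators_def gen_word_def)
  have bc: "(?b \<otimes>\<^bsub>Hgrp d\<^esub> ?c) [^]\<^bsub>Hgrp d\<^esub> d = \<one>\<^bsub>Hgrp d\<^esub>"
    using H_relator[of "[Gen_b, Gen_c]" d d] by (auto simp: relators_def gen_word_def)
  have bac: "(?b \<otimes>\<^bsub>Hgrp d\<^esub> (?a \<otimes>\<^bsub>Hgrp d\<^esub> ?c)) [^]\<^bsub>Hgrp d\<^esub> d = \<one>\<^bsub>Hgrp d\<^esub>"
    using H_relator[of "[Gen_b, Gen_a, Gen_c]" d d] by (auto simp: relators_def gen_word_def)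
  have aac: "?a \<otimes>\<^bsub>Hgrp d\<^esub> (?a \<otimes>\<^bsub>Hgrp d\<^esub> ?c) = ?c"
    by (simp add: m_assoc[symmetric] aa)
  have R: "eval_word (Hgrp d) f r = \<one>\<^bsub>Hgrp d\<^esub>" if "r \<in> relators d" for r
    using that unfolding relators_def
    by (auto simp: eval_word_pow[OF group_H f])
       (simp_all add: gen_word_def f_def aac ab ac bc bac, simp_all add: numeral_2_eq_2 aa bb cc)
  obtain h where h: "h \<in> hom (Hgrp d) (Hgrp d)"
    and ev: "\<And>w. h (word_class (relators d) w) = eval_word (Hgrp d) f w"
  proof (rule presented_group_universal[OF f, of "relators d"])
    show "eval_word (Hgrp d) f r = \<one>\<^bsub>Hgrp d\<^esub>" if "r \<in> relators d" for r
      using R that .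
  next
    fix h assume "h \<in> hom (presented_group (relators d)) (Hgrp d)"
      "\<And>w. h (word_class (relators d) w) = eval_word (Hgrp d) f w"
    then show thesis by (intro that) (simp_all only: Hgrp_def)
  qed
  interpret h: group_hom "Hgrp d" "Hgrp d" h using h by unfold_locales
  have ha: "h ?a = ?a" and hb: "h ?b = ?b" and hc: "h ?c = ?a \<otimes>\<^bsub>Hgrp d\<^esub> ?c"
    unfolding gen_a_def gen_b_def gen_c_def ev
    by (simp_all add: f_def) (simp_all add: gen_a_def gen_b_def gen_c_def)
  have hh: "h (h g) = g" if g: "g \<in> carrier (Hgrp d)" for g
  proof (rule hom_H_eqI[OF group_H, of "\<lambda>g. h (h g)" d d "\<lambda>g. g" g])
    show "h (h (gen_class d x)) = gen_class d x" for x
      by (cases x) (simp_all add: ha hb hc aac)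
  qed (use g in \<open>auto simp: hom_def\<close>)
  have "bij_betw h (carrier (Hgrp d)) (carrier (Hgrp d))"
    by (rule bij_betw_byWitness[where f' = h]) (auto simp: hh)
  then have "restrict h (carrier (Hgrp d)) \<in> auto (Hgrp d)"
    by (auto simp: auto_def Bij_def hom_def bij_betw_restrict_eq)
  then show "\<exists>f. f \<in> auto (Hgrp d) \<and> f ?a = ?a \<and> f ?b = ?b \<and> f ?c = ?a \<otimes>\<^bsub>Hgrp d\<^esub> ?c"
    by (intro exI[of _ "restrict h (carrier (Hgrp d))"]) (simp add: ha hb hc)
next
  fix f g
  assume *: "f \<in> auto (Hgrp d) \<and> f (gen_a d) = gen_a d \<and> f (gen_b d) = gen_b d \<and>
     f (gen_c d) = gen_a d \<otimes>\<^bsub>Hgrp d\<^esub> gen_c d"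
    "g \<in> auto (Hgrp d) \<and> g (gen_a d) = gen_a d \<and> g (gen_b d) = gen_b d \<and>
     g (gen_c d) = gen_a d \<otimes>\<^bsub>Hgrp d\<^esub> gen_c d"
  have "f (gen_class d x) = g (gen_class d x)" for x
    using * by (cases x) auto
  then have "f x = g x" if "x \<in> carrier (Hgrp d)" for x
    using hom_H_eqI[OF group_H, of f d d g x] * that by (auto simp: auto_def)
  then show "f = g"
    using * by (intro extensionalityI[of f "carrier (Hgrp d)" g]) (auto simp: auto_def Bij_def)
qed

definition meets_trivially :: "nat \<Rightarrow> gen word set set \<Rightarrow> bool" where
  "meets_trivially d V \<longleftrightarrow>
     (\<forall>g\<in>carrier (Hgrp d).
        \<forall>U\<in>{generate (Hgrp d) {gen_a d}, generate (Hgrp d) {gen_c d},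
            generate (Hgrp d) {gen_a d \<otimes>\<^bsub>Hgrp d\<^esub> gen_b d}, generate (Hgrp d) {gen_a d \<otimes>\<^bsub>Hgrp d\<^esub> gen_c d},
            generate (Hgrp d) {gen_b d \<otimes>\<^bsub>Hgrp d\<^esub> gen_c d}}.
          (inv\<^bsub>Hgrp d\<^esub> g <#\<^bsub>Hgrp d\<^esub> V #>\<^bsub>Hgrp d\<^esub> g) \<inter> U = {\<one>\<^bsub>Hgrp d\<^esub>})"

definition conjugate_to_sharp :: "nat \<Rightarrow> gen word set set \<Rightarrow> bool" where
  "conjugate_to_sharp d V \<longleftrightarrow>
     (\<exists>g\<in>carrier (Hgrp d). sharp d ` V = inv\<^bsub>Hgrp d\<^esub> g <#\<^bsub>Hgrp d\<^esub> V #>\<^bsub>Hgrp d\<^esub> g)"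

end

theory Submission
  imports Defs "HOL-Algebra.Multiplicative_Group"
begin

text \<open>
  Everything rests on one fact: \<open>bc\<close> has order exactly \<open>d\<close> in \<open>H\<^sub>d\<close>; then \<open>a\<close>, \<open>c\<close>, \<open>ab\<close>, \<open>ac\<close> have
  orders \<open>2, 2, 3, 2\<close>. Given these orders, consider a transitive action of \<open>H\<^sub>d\<close> with a point
  stabilizer \<open>V\<close>. The conjugates of \<open>V\<close> are the point stabilizers, so condition (1) says that the five
  cyclic subgroups act freely, which is the cycle structure required of a degree-\<open>d\<close>-surface. An
  isomorphism onto the geodesic dual is a bijection \<open>\<phi>\<close> with \<open>\<phi> (g f) = #g (\<phi> f)\<close>, and such a
  \<open>\<phi>\<close> exists iff \<open>V\<^sup>#\<close> is a point stabilizer. Conversely, on a self-dual degree-\<open>d\<close>-surface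
  \<open>\<beta>\<alpha>\<gamma>\<close> is conjugate to \<open>\<beta>\<gamma>\<close> by \<open>\<phi>\<close>, hence all relators of \<open>H\<^sub>d\<close> act trivially.

  For the order of \<open>bc\<close> we construct permutations \<open>a, b, c\<close> of a finite set satisfying the relations
  such that \<open>bc\<close> and \<open>bac\<close> both have precisely two nontrivial cycles, of length \<open>d\<close>. If \<open>a\<close> and \<open>b\<close> agree
  on a pair of points lying on different cycles, then eight points can be added so that all four cycles
  grow by four and a pair of this kind remains. Starting from \<open>d = 6, 8, 9, 15\<close> this reaches
  all \<open>d\<close> in question except \<open>5\<close> and \<open>11\<close>.
\<close>

section \<open>Permutations with two nontrivial cycles\<close>

text \<open>\<open>x'\<close> and \<open>y'\<close> are the points just before \<open>x\<close> and
  \<open>y\<close>, so each cycle is recorded cut open at one arc, \<open>x' -> x\<close> or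
  \<open>y' -> y\<close>. New points are spliced in at these arcs.\<close>

definition two_cycles ::
    "nat \<Rightarrow> nat \<Rightarrow> (nat \<Rightarrow> nat) \<Rightarrow> nat \<Rightarrow> nat \<Rightarrow> nat \<Rightarrow> nat \<Rightarrow> bool" where
  "two_cycles n d f x x' y y' \<longleftrightarrow>
     (\<exists>P Q. distinct (P @ Q) \<and> P \<noteq> [] \<and> Q \<noteq> [] \<and> length P = d \<and> length Q = d \<and>
        set (P @ Q) \<subseteq> {..<n} \<and> (\<forall>w. w \<notin> set (P @ Q) \<longrightarrow> f w = w) \<and>
        successively (\<lambda>u v. f u = v) P \<and> hd P = x \<and> last P = x' \<and> f x' = x \<and>
        successively (\<lambda>u v. f u = v) Q \<and> hd Q = y \<and> last Q = y' \<and> f y' = y)"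

lemma two_cycles_swap: "two_cycles n d f x x' y y' \<Longrightarrow> two_cycles n d f y y' x x'"
proof -
  assume "two_cycles n d f x x' y y'"
  then obtain P Q where "distinct (P @ Q) \<and> P \<noteq> [] \<and> Q \<noteq> [] \<and> length P = d \<and> length Q = d \<and>
      set (P @ Q) \<subseteq> {..<n} \<and> (\<forall>w. w \<notin> set (P @ Q) \<longrightarrow> f w = w) \<and>
      successively (\<lambda>u v. f u = v) P \<and> hd P = x \<and> last P = x' \<and> f x' = x \<and>
      successively (\<lambda>u v. f u = v) Q \<and> hd Q = y \<and> last Q = y' \<and> f y' = y"
    unfolding two_cycles_def by blast
  then show ?thesis
    unfolding two_cycles_def by (intro exI[of _ Q] exI[of _ P]) auto
qed

lemma funpow_successively:
  "successively (\<lambda>u v. f u = v) P \<Longrightarrow> i < length P \<Longrightarrow> (f ^^ i) (hd P) = P ! i"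
proof (induction i)
  case 0
  then show ?case by (simp add: hd_conv_nth)
next
  case (Suc i)
  then have "f (P ! i) = P ! Suc i" by (auto simp: successively_conv_nth)
  with Suc show ?case by simp
qed

lemma funpow_cycle:
  assumes "successively (\<lambda>u v. f u = v) P" "P \<noteq> []" "f (last P) = hd P" "w \<in> set P"
  shows "(f ^^ length P) w = w"
proof -
  let ?d = "length P"
  have d: "?d = Suc (?d - 1)" using assms(2) by (cases P) auto
  have "(f ^^ (?d - 1)) (hd P) = last P"
    using funpow_successively[OF assms(1), of "?d - 1"] assms(2) by (simp add: last_conv_nth)
  then have *: "(f ^^ ?d) (hd P) = hd P"
    by (subst d) (simp add: assms(3))
  obtain i where i: "i < ?d" "w = P ! i" using assms(4) by (metis in_set_conv_nth)
  then have w: "w = (f ^^ i) (hd P)" using funpow_successively[OF assms(1)] by simp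
  have "(f ^^ ?d) w = (f ^^ i) ((f ^^ ?d) (hd P))"
    unfolding w by (metis add.commute comp_apply funpow_add)
  then show ?thesis by (simp add: * w)
qed

lemma two_cycles_funpow:
  assumes "two_cycles n d f x x' y y'"
  shows "(f ^^ d) w = w"
proof -
  obtain P Q where PQ: "P \<noteq> []" "Q \<noteq> []" "length P = d" "length Q = d"
      "\<forall>w. w \<notin> set (P @ Q) \<longrightarrow> f w = w"
      "successively (\<lambda>u v. f u = v) P" "f (last P) = hd P"
      "successively (\<lambda>u v. f u = v) Q" "f (last Q) = hd Q"
    using assms unfolding two_cycles_def by blast
  consider "w \<in> set P" | "w \<in> set Q" | "f w = w" using PQ(5) by auto
  then show ?thesis
  proof cases
    case 3
    then show ?thesis by (induction d) auto
  qed (use funpow_cycle[of f P w] funpow_cycle[of f Q w] PQ in auto)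
qed

text \<open>Reduce \<open>k\<close> modulo \<open>d\<close>. Since the listing \<open>P\<close> has
  no repetitions, \<open>P ! (k mod d) = hd P\<close> forces \<open>k mod d = 0\<close>.\<close>

lemma two_cycles_period:
  assumes "two_cycles n d f x x' y y'" "(f ^^ k) x = x"
  shows "d dvd k"
proof -
  obtain P where P: "P \<noteq> []" "length P = d" "distinct P" "hd P = x"
      "successively (\<lambda>u v. f u = v) P"
    using assms unfolding two_cycles_def by auto
  have d: "d > 0" using P by auto
  have "(f ^^ (k mod d)) x = x"
    using two_cycles_funpow[OF assms(1)] assms(2) funpow_mod_eq by metis
  then have "P ! (k mod d) = P ! 0"
    using funpow_successively[OF P(5), of "k mod d"] d P by (simp add: hd_conv_nth)
  then show ?thesis
    using nth_eq_iff_index_eq[OF P(3), of "k mod d" 0] d P(2) by auto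
qed

text \<open>The arcs \<open>x' -> x\<close> and \<open>y' -> y\<close> are replaced by the paths
  \<open>x' -> p1 -> p2 -> p3 -> p0 -> x\<close> and \<open>y' -> q3 -> q0 -> q1 -> q2 -> y\<close>.
  The longer cycles are cut at \<open>p3 -> p0\<close> and \<open>q3 -> q0\<close>, inside the new
  paths, so that the next splice can take place there.\<close>

lemma two_cycles_insert:
  assumes tc: "two_cycles n d f x x' y y'"
    and new: "distinct [p0, p1, p2, p3, q0, q1, q2, q3]"
      "set [p0, p1, p2, p3, q0, q1, q2, q3] = {n..<n + 8}"
    and f': "f' p0 = x" "f' x' = p1" "f' p1 = p2" "f' p2 = p3" "f' p3 = p0"
      "f' q0 = q1" "f' q1 = q2" "f' q2 = y" "f' y' = q3" "f' q3 = q0"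
    and old: "\<And>w. w \<notin> {x', y'} \<Longrightarrow> w \<notin> {n..<n + 8} \<Longrightarrow> f' w = f w"
  shows "two_cycles (n + 8) (d + 4) f' p0 p3 q0 q3"
proof -
  obtain P Q where PQ: "distinct (P @ Q)" "P \<noteq> []" "Q \<noteq> []" "length P = d" "length Q = d"
      "set (P @ Q) \<subseteq> {..<n}" "\<forall>w. w \<notin> set (P @ Q) \<longrightarrow> f w = w"
      "successively (\<lambda>u v. f u = v) P" "hd P = x" "last P = x'" "f x' = x"
      "successively (\<lambda>u v. f u = v) Q" "hd Q = y" "last Q = y'" "f y' = y"
    using tc unfolding two_cycles_def by blast
  have below: "w < n" if "w \<in> set P \<or> w \<in> set Q" for w using PQ(6) that by auto
  have last_in: "x' \<in> set P" "y' \<in> set Q" using PQ by auto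
  \<comment> \<open>Among the old points \<open>f'\<close> redirects only \<open>x'\<close> and
    \<open>y'\<close>, the last entries of the two lists, so it agrees with \<open>f\<close> at
    every earlier entry.\<close>
  have succ: "successively (\<lambda>u v. f' u = v) P'"
    if "successively (\<lambda>u v. f u = v) P'" "distinct P'" "P' = P \<or> P' = Q" for P'
    unfolding successively_conv_nth
  proof (intro allI impI)
    fix i assume i: "Suc i < length P'"
    then have "P' ! i \<noteq> last P'"
      using that PQ nth_eq_iff_index_eq[OF that(2), of i "length P' - 1"]
      by (auto simp: last_conv_nth)
    moreover have "P' ! i \<in> set P'" using i by simp
    moreover have "x' \<notin> set Q" "y' \<notin> set P" using PQ(1) last_in by auto
    ultimately have "P' ! i \<notin> {x', y'}" "P' ! i < n"
      using that(3) PQ(10,14) below by auto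
    then have "f' (P' ! i) = f (P' ! i)" by (intro old) auto
    then show "f' (P' ! i) = P' ! Suc i" using that(1) i by (simp add: successively_conv_nth)
  qed
  have nn: "w \<ge> n" "w < n + 8" if "w \<in> {p0, p1, p2, p3, q0, q1, q2, q3}" for w
    using that new(2) by auto
  have notin: "w \<notin> set P" "w \<notin> set Q" if "w \<in> {p0, p1, p2, p3, q0, q1, q2, q3}" for w
    using nn(1)[OF that] below[of w] by auto
  show ?thesis
    unfolding two_cycles_def
  proof (intro exI conjI)
    let ?P = "[p0] @ P @ [p1, p2, p3]" and ?Q = "[q0, q1, q2] @ Q @ [q3]"
    show "distinct (?P @ ?Q)"
      using PQ(1) new(1) by (auto simp: notin)
    show "set (?P @ ?Q) \<subseteq> {..<n + 8}"
    proof
      fix w assume "w \<in> set (?P @ ?Q)"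
      then consider "w \<in> {p0, p1, p2, p3, q0, q1, q2, q3}" | "w \<in> set P \<or> w \<in> set Q" by auto
      then show "w \<in> {..<n + 8}"
      proof cases
        case 1
        then show ?thesis using nn(2) by blast
      next
        case 2
        then show ?thesis using below[of w] by simp
      qed
    qed
    show "\<forall>w. w \<notin> set (?P @ ?Q) \<longrightarrow> f' w = w"
    proof (intro allI impI)
      fix w assume w: "w \<notin> set (?P @ ?Q)"
      then have "w \<notin> set [p0, p1, p2, p3, q0, q1, q2, q3]" by auto
      then have "w \<notin> {n..<n + 8}" using new(2) by blast
      moreover have "w \<notin> {x', y'}" using w last_in by auto
      ultimately show "f' w = w" using old PQ(7) w by auto
    qed
    have "successively (\<lambda>u v. f' u = v) P" "successively (\<lambda>u v. f' u = v) Q"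
      using succ[OF PQ(8)] succ[OF PQ(12)] PQ(1) by auto
    then show "successively (\<lambda>u v. f' u = v) ?P" "successively (\<lambda>u v. f' u = v) ?Q"
      by (simp_all add: successively_append_iff successively_Cons PQ f')
  qed (simp_all add: PQ f')
qed

section \<open>Permutation representations in which \<open>bc\<close> has order \<open>d\<close>\<close>

text \<open>For involutions the braid relation says \<open>(ab)^3 = 1\<close> and commutation says
  \<open>(ac)^2 = 1\<close>. Permutations of all natural numbers that fix everything from
  \<open>n\<close> on leave room for adding points.\<close>

definition triangle_rep :: "nat \<Rightarrow> (nat \<Rightarrow> nat) \<Rightarrow> (nat \<Rightarrow> nat) \<Rightarrow> (nat \<Rightarrow> nat) \<Rightarrow> bool" where
  "triangle_rep n a b c \<longleftrightarrow>
     (\<forall>x. a (a x) = x \<and> b (b x) = x \<and> c (c x) = x \<and> a (b (a x)) = b (a (b x)) \<and>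
        a (c x) = c (a x)) \<and>
     (\<forall>x\<ge>n. a x = x \<and> b x = x \<and> c x = x)"

definition order_rep :: "nat \<Rightarrow> bool" where
  "order_rep d \<longleftrightarrow> (\<exists>n a b c x x' y y' u u' v v'. triangle_rep n a b c \<and>
     two_cycles n d (\<lambda>x. b (c x)) x x' y y' \<and> two_cycles n d (\<lambda>x. b (a (c x))) u u' v v')"

text \<open>The endpoints recorded for the cycles say that \<open>y\<close> and \<open>z\<close> lie on different cycles, of \<open>bc\<close> as
  well as of \<open>bac\<close>; otherwise \<open>extensible_rep_add4\<close> would lengthen a single cycle by eight.\<close>

definition extensible_rep :: "nat \<Rightarrow> bool" where
  "extensible_rep d \<longleftrightarrow> (\<exists>n a b c y z. triangle_rep n a b c \<and> a y = z \<and> b y = z \<and>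
     two_cycles n d (\<lambda>x. b (c x)) z (c y) y (c z) \<and>
     two_cycles n d (\<lambda>x. b (a (c x))) z (c z) y (c y))"

lemma extensible_imp_order_rep: "extensible_rep d \<Longrightarrow> order_rep d"
  unfolding extensible_rep_def order_rep_def by blast

lemma nat_cases_8:
  fixes x n :: nat
  assumes "x < n \<Longrightarrow> P" "x = n \<Longrightarrow> P" "x = n + 1 \<Longrightarrow> P" "x = n + 2 \<Longrightarrow> P" "x = n + 3 \<Longrightarrow> P"
    "x = n + 4 \<Longrightarrow> P" "x = n + 5 \<Longrightarrow> P" "x = n + 6 \<Longrightarrow> P" "x = n + 7 \<Longrightarrow> P" "x \<ge> n + 8 \<Longrightarrow> P"
  shows P
  using assms by linarith

text \<open>The pair \<open>{y, z}\<close> on which \<open>a\<close> and \<open>b\<close> agree is blown up to a hexagon (a free orbit of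
  \<open>\<langle>a, b\<rangle>\<close>) with vertices \<open>y, n, n+3, n+2, n+1, z\<close>, to whose two new \<open>a\<close>-edges pairs of the same kind
  as \<open>{y, z}\<close>, namely \<open>{n+4, n+5}\<close> and \<open>{n+6, n+7}\<close>, are attached by \<open>c\<close>. This inserts four points
  into every nontrivial cycle of \<open>bc\<close> and of \<open>bac\<close>.\<close>

lemma extensible_rep_add4:
  assumes "extensible_rep d"
  shows "extensible_rep (d + 4)"
proof -
  obtain n a b c y z where rep: "triangle_rep n a b c" and ayz: "a y = z" and byz: "b y = z"
    and T: "two_cycles n d (\<lambda>x. b (c x)) z (c y) y (c z)"
    and F: "two_cycles n d (\<lambda>x. b (a (c x))) z (c z) y (c y)"
    using assms unfolding extensible_rep_def by blast
  have inv: "a (a x) = x" "b (b x) = x" "c (c x) = x" "a (c x) = c (a x)"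
    and braid: "a (b (a x)) = b (a (b x))"
    and fix_ge: "x \<ge> n \<Longrightarrow> a x = x" "x \<ge> n \<Longrightarrow> b x = x" "x \<ge> n \<Longrightarrow> c x = x" for x
    using rep unfolding triangle_rep_def by auto
  have azy: "a z = y" and bzy: "b z = y" using ayz byz inv by metis+
  obtain P Q where "distinct (P @ Q)" "P \<noteq> []" "Q \<noteq> []" "hd P = z" "hd Q = y"
      "set (P @ Q) \<subseteq> {..<n}"
    using T unfolding two_cycles_def by blast
  then have "z \<in> set P" "y \<in> set Q" "set P \<inter> set Q = {}" "set P \<union> set Q \<subseteq> {..<n}" by auto
  then have yz: "y \<noteq> z" "y < n" "z < n" by auto
  have lt: "a x < n" "b x < n" "c x < n" if "x < n" for x
    using that inv fix_ge by (metis not_less)+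
  define a' where "a' = a(n := n+3, n+3 := n, n+1 := n+2, n+2 := n+1,
    n+4 := n+5, n+5 := n+4, n+6 := n+7, n+7 := n+6)"
  define b' where "b' = b(y := n, n := y, z := n+1, n+1 := z, n+2 := n+3, n+3 := n+2,
    n+4 := n+5, n+5 := n+4, n+6 := n+7, n+7 := n+6)"
  define c' where "c' = c(n := n+7, n+7 := n, n+1 := n+4, n+4 := n+1, n+2 := n+5, n+5 := n+2,
    n+3 := n+6, n+6 := n+3)"
  have a'_new: "a' n = n+3" "a' (n+1) = n+2" "a' (n+2) = n+1" "a' (n+3) = n" "a' (n+4) = n+5"
      "a' (n+5) = n+4" "a' (n+6) = n+7" "a' (n+7) = n+6"
    and b'_new: "b' n = y" "b' (n+1) = z" "b' (n+2) = n+3" "b' (n+3) = n+2" "b' (n+4) = n+5"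
      "b' (n+5) = n+4" "b' (n+6) = n+7" "b' (n+7) = n+6" "b' y = n" "b' z = n+1"
    and c'_new: "c' n = n+7" "c' (n+1) = n+4" "c' (n+2) = n+5" "c' (n+3) = n+6" "c' (n+4) = n+1"
      "c' (n+5) = n+2" "c' (n+6) = n+3" "c' (n+7) = n"
    using yz by (auto simp: a'_def b'_def c'_def)
  have a'_old: "a' x = a x" and c'_old: "c' x = c x" and b'_old: "x \<noteq> y \<Longrightarrow> x \<noteq> z \<Longrightarrow> b' x = b x"
    if "x \<notin> {n..<n + 8}" for x
    using that by (auto simp: a'_def b'_def c'_def)
  note new = a'_new b'_new c'_new
  note [simp del] = One_nat_def add_2_eq_Suc'
  have old_lt: "a' x = a x" "c' x = c x" "x \<noteq> y \<Longrightarrow> x \<noteq> z \<Longrightarrow> b' x = b x" if "x < n" for x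
    using a'_old[of x] b'_old[of x] c'_old[of x] that by auto
  have old_ge: "a' x = x" "c' x = x" "b' x = x" if "x \<ge> n + 8" for x
    using a'_old[of x] b'_old[of x] c'_old[of x] that fix_ge[of x] yz by auto
  have b_ne: "b x \<noteq> y \<longleftrightarrow> x \<noteq> z" "b x \<noteq> z \<longleftrightarrow> x \<noteq> y" "a x \<noteq> y \<longleftrightarrow> x \<noteq> z" "a x \<noteq> z \<longleftrightarrow> x \<noteq> y" for x
    using inv ayz byz azy bzy by metis+
  have "triangle_rep (n + 8) a' b' c'"
    unfolding triangle_rep_def
  proof (intro conjI allI impI)
    fix x
    show "a' (a' x) = x"
      by (rule nat_cases_8[of x n]) (simp_all only: new old_lt old_ge lt inv)
    show "b' (b' x) = x"
    proof (rule nat_cases_8[of x n])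
      assume "x < n"
      then show ?thesis
        by (cases "x = y"; cases "x = z") (simp_all add: new old_lt lt inv b_ne)
    qed (simp_all only: new old_lt old_ge lt inv)
    show "c' (c' x) = x"
      by (rule nat_cases_8[of x n]) (simp_all only: new old_lt old_ge lt inv)
    show "a' (c' x) = c' (a' x)"
      by (rule nat_cases_8[of x n]) (simp_all only: new old_lt old_ge lt inv)
    show "a' (b' (a' x)) = b' (a' (b' x))"
    proof (rule nat_cases_8[of x n])
      assume x: "x < n"
      \<comment> \<open>\<open>{y, z}\<close> is an orbit of \<open>a\<close> and \<open>b\<close>,
        so their other orbits stay as they are. From \<open>y\<close> or \<open>z\<close> the two
        sides of the braid relation run around the new hexagon in opposite directions and meet at
        the opposite vertex.\<close>
      show ?thesis
      proof (cases "x = y \<or> x = z")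
        case True
        then show ?thesis using yz by (auto simp: new old_lt ayz azy)
      next
        case False
        then have "b (a x) \<noteq> y \<and> b (a x) \<noteq> z \<and> b x \<noteq> y \<and> b x \<noteq> z \<and> a (b x) \<noteq> y \<and> a (b x) \<noteq> z \<and>
          a x \<noteq> y \<and> a x \<noteq> z"
          using b_ne by metis
        then show ?thesis using x False by (simp add: old_lt lt braid)
      qed
    qed (simp_all only: new old_lt old_ge lt inv yz ayz azy)
  next
    fix x assume "n + 8 \<le> x"
    then show "a' x = x" "b' x = x" "c' x = x" using old_ge by auto
  qed
  \<comment> \<open>The pair \<open>{n+5, n+4}\<close> succeeds \<open>{y, z}\<close>, with
    \<open>n+4\<close> in the place of \<open>z\<close>.\<close>
  moreover have "a' (n+5) = n+4" "b' (n+5) = n+4" by (fact new)+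
  \<comment> \<open>The arc \<open>c y -> z\<close> becomes
    \<open>c y -> n -> n+6 -> n+2 -> n+4 -> z\<close>, and \<open>c z -> y\<close> becomes
    \<open>c z -> n+1 -> n+5 -> n+3 -> n+7 -> y\<close>.\<close>
  moreover have "two_cycles (n + 8) (d + 4) (\<lambda>x. b' (c' x)) (n+4) (c' (n+5)) (n+5) (c' (n+4))"
    unfolding new
  proof (rule two_cycles_insert[OF T, where ?p1.0 = n and ?p2.0 = "n+6" and ?q1.0 = "n+3"
        and ?q2.0 = "n+7"])
    fix w assume w: "w \<notin> {c y, c z}" "w \<notin> {n..<n + 8}"
    then have "c w \<noteq> y" "c w \<noteq> z" using inv by auto
    moreover have "c w \<notin> {n..<n + 8}"
      using w lt(3)[of w] fix_ge(3)[of w] by (cases "w < n") auto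
    ultimately show "b' (c' w) = b (c w)" using w by (simp add: b'_old c'_old)
  next
    show "set [n+4, n, n+6, n+2, n+5, n+3, n+7, n+1] = {n..<n + 8}"
      unfolding set_eq_iff list.set insert_iff atLeastLessThan_iff empty_iff by presburger
  qed (simp_all add: new old_lt inv yz lt)
  \<comment> \<open>Now \<open>c z -> z\<close> becomes
    \<open>c z -> n -> n+7 -> n+2 -> n+5 -> z\<close>, and \<open>c y -> y\<close> becomes
    \<open>c y -> n+1 -> n+4 -> n+3 -> n+6 -> y\<close>. The old \<open>z\<close> lies on the cycle
    of \<open>n+5\<close>, so the two cycles are swapped to list \<open>n+4\<close> first.\<close>
  moreover have "two_cycles (n + 8) (d + 4) (\<lambda>x. b' (a' (c' x))) (n+4) (c' (n+4)) (n+5) (c' (n+5))"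
    unfolding new
  proof (rule two_cycles_swap, rule two_cycles_insert[OF F, where ?p1.0 = n and ?p2.0 = "n+7"
        and ?q1.0 = "n+3" and ?q2.0 = "n+6"])
    fix w assume w: "w \<notin> {c z, c y}" "w \<notin> {n..<n + 8}"
    then have "c w \<noteq> y" "c w \<noteq> z" using inv by auto
    then have "a (c w) \<noteq> y" "a (c w) \<noteq> z" using b_ne by metis+
    moreover have "c w \<notin> {n..<n + 8}" "a (c w) \<notin> {n..<n + 8}"
      using w lt(3)[of w] lt(1)[of "c w"] fix_ge[of w] by (cases "w < n"; auto)+
    ultimately show "b' (a' (c' w)) = b (a (c w))" using w by (simp add: a'_old b'_old c'_old)
  next
    show "set [n+5, n, n+7, n+2, n+4, n+3, n+6, n+1] = {n..<n + 8}"
      unfolding set_eq_iff list.set insert_iff atLeastLessThan_iff empty_iff by presburger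
  qed (simp_all add: new old_lt inv yz lt ayz azy)
  ultimately show ?thesis unfolding extensible_rep_def by blast
qed

section \<open>Checking explicit permutations by computation\<close>

definition perm_of_list :: "nat list \<Rightarrow> nat \<Rightarrow> nat" where
  "perm_of_list xs x = (if x < length xs then xs ! x else x)"

definition check_triangle_rep :: "nat list \<Rightarrow> nat list \<Rightarrow> nat list \<Rightarrow> bool" where
  "check_triangle_rep as bs cs \<longleftrightarrow> length bs = length as \<and> length cs = length as \<and>
     list_all (\<lambda>x. as ! (as ! x) = x \<and> bs ! (bs ! x) = x \<and> cs ! (cs ! x) = x \<and>
       as ! (bs ! (as ! x)) = bs ! (as ! (bs ! x)) \<and> as ! (cs ! x) = cs ! (as ! x) \<and>
       as ! x < length as \<and> bs ! x < length as \<and> cs ! x < length as) [0..<length as]"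

text \<open>The equation \<open>map f P = rotate1 P\<close> is an executable form of the cycle
  condition; it includes the closing arc from the last entry to the first.\<close>

definition check_two_cycles :: "nat \<Rightarrow> (nat \<Rightarrow> nat) \<Rightarrow> nat list \<Rightarrow> nat list \<Rightarrow> bool" where
  "check_two_cycles n f P Q \<longleftrightarrow> distinct (P @ Q) \<and> P \<noteq> [] \<and> length Q = length P \<and>
     list_all (\<lambda>w. w < n) (P @ Q) \<and> list_all (\<lambda>w. w \<in> set (P @ Q) \<or> f w = w) [0..<n] \<and>
     map f P = rotate1 P \<and> map f Q = rotate1 Q"

lemma triangle_rep_check:
  assumes "check_triangle_rep as bs cs"
  shows "triangle_rep (length as) (perm_of_list as) (perm_of_list bs) (perm_of_list cs)"
  unfolding triangle_rep_def
proof (intro conjI allI)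
  fix x
  have "length bs = length as" "length cs = length as"
    using assms unfolding check_triangle_rep_def by auto
  moreover have "x < length as \<Longrightarrow> as ! (as ! x) = x \<and> bs ! (bs ! x) = x \<and> cs ! (cs ! x) = x \<and>
       as ! (bs ! (as ! x)) = bs ! (as ! (bs ! x)) \<and> as ! (cs ! x) = cs ! (as ! x)"
    and "\<And>x. x < length as \<Longrightarrow> as ! x < length as \<and> bs ! x < length as \<and> cs ! x < length as"
    using assms unfolding check_triangle_rep_def list_all_iff by auto
  ultimately show "perm_of_list as (perm_of_list as x) = x" "perm_of_list bs (perm_of_list bs x) = x"
    "perm_of_list cs (perm_of_list cs x) = x"
    "perm_of_list as (perm_of_list bs (perm_of_list as x)) =
       perm_of_list bs (perm_of_list as (perm_of_list bs x))"
    "perm_of_list as (perm_of_list cs x) = perm_of_list cs (perm_of_list as x)"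
    "length as \<le> x \<longrightarrow> perm_of_list as x = x \<and> perm_of_list bs x = x \<and> perm_of_list cs x = x"
    by (auto simp: perm_of_list_def)
qed

lemma map_eq_rotate1_cycle:
  assumes "map f P = rotate1 P" "P \<noteq> []"
  shows "successively (\<lambda>u v. f u = v) P" "f (last P) = hd P"
proof -
  have nth: "f (P ! i) = P ! (Suc i mod length P)" if "i < length P" for i
    using arg_cong[OF assms(1), of "\<lambda>xs. xs ! i"] that by (simp add: nth_rotate1)
  show "successively (\<lambda>u v. f u = v) P"
    unfolding successively_conv_nth by (auto simp: nth)
  have "f (P ! (length P - 1)) = P ! 0" using nth[of "length P - 1"] assms(2) by simp
  then show "f (last P) = hd P" using assms(2) by (simp add: last_conv_nth hd_conv_nth)
qed

lemma two_cycles_check: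
  assumes "check_two_cycles n f P Q" "\<And>w. n \<le> w \<Longrightarrow> f w = w"
  shows "two_cycles n (length P) f (hd P) (last P) (hd Q) (last Q)"
proof -
  have PQ: "distinct (P @ Q)" "P \<noteq> []" "length Q = length P" "Q \<noteq> []"
      "set (P @ Q) \<subseteq> {..<n}" "map f P = rotate1 P" "map f Q = rotate1 Q"
    and fixed: "\<And>w. w < n \<Longrightarrow> w \<notin> set (P @ Q) \<Longrightarrow> f w = w"
    using assms(1) unfolding check_two_cycles_def list_all_iff by auto
  have "f w = w" if "w \<notin> set (P @ Q)" for w
    using fixed assms(2) that by (cases "w < n") auto
  then show ?thesis
    unfolding two_cycles_def
    using PQ map_eq_rotate1_cycle[OF PQ(6,2)] map_eq_rotate1_cycle[OF PQ(7,4)]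
    by (intro exI[of _ P] exI[of _ Q]) auto
qed

lemma perm_of_list_ge: "length xs \<le> w \<Longrightarrow> perm_of_list xs w = w"
  by (simp add: perm_of_list_def)

lemma two_cycles_perm_check:
  assumes "check_triangle_rep as bs cs"
    "check_two_cycles (length as) (\<lambda>x. perm_of_list bs (perm_of_list cs x)) P Q"
    "check_two_cycles (length as)
       (\<lambda>x. perm_of_list bs (perm_of_list as (perm_of_list cs x))) R S"
  shows "two_cycles (length as) (length P) (\<lambda>x. perm_of_list bs (perm_of_list cs x))
      (hd P) (last P) (hd Q) (last Q)"
    "two_cycles (length as) (length R)
      (\<lambda>x. perm_of_list bs (perm_of_list as (perm_of_list cs x))) (hd R) (last R) (hd S) (last S)"
proof -
  have len: "length bs = length as" "length cs = length as"
    using assms(1) by (auto simp: check_triangle_rep_def)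
  show "two_cycles (length as) (length P) (\<lambda>x. perm_of_list bs (perm_of_list cs x))
      (hd P) (last P) (hd Q) (last Q)"
    by (rule two_cycles_check[OF assms(2)]) (simp add: perm_of_list_ge len)
  show "two_cycles (length as) (length R)
      (\<lambda>x. perm_of_list bs (perm_of_list as (perm_of_list cs x))) (hd R) (last R) (hd S) (last S)"
    by (rule two_cycles_check[OF assms(3)]) (simp add: perm_of_list_ge len)
qed

lemma order_rep_check:
  assumes "check_triangle_rep as bs cs"
    "check_two_cycles (length as) (\<lambda>x. perm_of_list bs (perm_of_list cs x)) P Q"
    "check_two_cycles (length as)
       (\<lambda>x. perm_of_list bs (perm_of_list as (perm_of_list cs x))) R S"
    "length P = d" "length R = d"
  shows "order_rep d"
  unfolding order_rep_def
  using triangle_rep_check[OF assms(1)] two_cycles_perm_check[OF assms(1-3), unfolded assms(4,5)]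
  by blast

lemma extensible_rep_check:
  assumes "check_triangle_rep as bs cs"
    "check_two_cycles (length as) (\<lambda>x. perm_of_list bs (perm_of_list cs x)) P Q"
    "check_two_cycles (length as)
       (\<lambda>x. perm_of_list bs (perm_of_list as (perm_of_list cs x))) R S"
    "length P = d" "length R = d"
    "hd P = z" "hd Q = y" "hd R = z" "hd S = y" "perm_of_list as y = z" "perm_of_list bs y = z"
    "last P = perm_of_list cs y" "last Q = perm_of_list cs z"
    "last S = perm_of_list cs y" "last R = perm_of_list cs z"
  shows "extensible_rep d"
  unfolding extensible_rep_def
  using triangle_rep_check[OF assms(1)] two_cycles_perm_check[OF assms(1-3), unfolded assms(4-9,12-15)]
    assms(10,11)
  by blast

text \<open>The permutations below were found by a random computer search among gluings of hexagons and
  of pairs as in \<open>extensible_rep_add4\<close>. The gluings found for \<open>d = 5\<close> and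
  \<open>d = 11\<close> contain no such pair, so they cannot be extended.\<close>

lemma order_rep_5: "order_rep 5"
  by (rule order_rep_check[
    where as = "[5, 2, 1, 4, 3, 0, 11, 8, 7, 10, 9, 6]"
      and bs = "[1, 0, 3, 2, 5, 4, 7, 6, 9, 8, 11, 10]"
      and cs = "[2, 5, 0, 10, 9, 1, 7, 6, 11, 4, 3, 8]"
      and P = "[0, 3, 11, 9, 5]"
      and Q = "[1, 4, 8, 10, 2]"
      and R = "[2, 4, 11, 6, 9]"
      and S = "[3, 8, 7, 10, 5]"])
    code_simp+

lemma extensible_rep_6: "extensible_rep 6"
  by (rule extensible_rep_check[
    where as = "[5, 2, 1, 4, 3, 0, 7, 6, 9, 8, 11, 10]"
      and bs = "[1, 0, 3, 2, 5, 4, 7, 6, 9, 8, 11, 10]"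
      and cs = "[10, 7, 6, 9, 8, 11, 2, 1, 4, 3, 0, 5]"
      and P = "[11, 4, 9, 2, 7, 0]"
      and Q = "[10, 1, 6, 3, 8, 5]"
      and R = "[11, 1, 7, 3, 9, 5]"
      and S = "[10, 4, 8, 2, 6, 0]"
      and y = 10 and z = 11])
    code_simp+

lemma extensible_rep_8: "extensible_rep 8"
  by (rule extensible_rep_check[
    where as = "[5, 2, 1, 4, 3, 0, 11, 8, 7, 10, 9, 6, 13, 12, 15, 14]"
      and bs = "[1, 0, 3, 2, 5, 4, 7, 6, 9, 8, 11, 10, 13, 12, 15, 14]"
      and cs = "[12, 6, 11, 7, 8, 13, 1, 3, 4, 14, 15, 2, 0, 5, 9, 10]"
      and P = "[15, 11, 3, 6, 0, 13, 4, 9]"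
      and Q = "[14, 8, 5, 12, 1, 7, 2, 10]"
      and R = "[15, 8, 2, 7, 5, 13, 1, 10]"
      and S = "[14, 11, 0, 12, 4, 6, 3, 9]"
      and y = 14 and z = 15])
    code_simp+

lemma extensible_rep_9: "extensible_rep 9"
  by (rule extensible_rep_check[
    where as = "[5, 2, 1, 4, 3, 0, 11, 8, 7, 10, 9, 6, 17, 14, 13, 16, 15, 12, 19, 18]"
      and bs = "[1, 0, 3, 2, 5, 4, 7, 6, 9, 8, 11, 10, 13, 12, 15, 14, 17, 16, 19, 18]"
      and cs = "[2, 5, 0, 10, 9, 1, 12, 18, 19, 4, 3, 17, 6, 16, 15, 14, 13, 11, 7, 8]"
      and P = "[19, 9, 5, 0, 3, 11, 16, 12, 7]"
      and Q = "[18, 6, 13, 17, 10, 2, 1, 4, 8]"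
      and R = "[19, 6, 16, 15, 12, 10, 5, 3, 8]"
      and S = "[18, 9, 2, 4, 11, 13, 14, 17, 7]"
      and y = 18 and z = 19])
    code_simp+

lemma order_rep_11: "order_rep 11"
  by (rule order_rep_check[
    where as = "[5, 2, 1, 4, 3, 0, 11, 8, 7, 10, 9, 6, 17, 14, 13, 16, 15, 12, 23, 20, 19, 22,
          21, 18]"
      and bs = "[1, 0, 3, 2, 5, 4, 7, 6, 9, 8, 11, 10, 13, 12, 15, 14, 17, 16, 19, 18, 21, 20,
          23, 22]"
      and cs = "[2, 5, 0, 8, 7, 1, 14, 4, 3, 16, 15, 13, 20, 11, 6, 10, 9, 19, 21, 17, 12, 18,
          23, 22]"
      and P = "[0, 3, 9, 17, 18, 20, 13, 10, 14, 7, 5]"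
      and Q = "[1, 4, 6, 15, 11, 12, 21, 19, 16, 8, 2]"
      and R = "[2, 4, 9, 14, 10, 17, 21, 22, 19, 13, 7]"
      and S = "[3, 6, 12, 18, 23, 20, 16, 11, 15, 8, 5]"])
    code_simp+

lemma extensible_rep_15: "extensible_rep 15"
  by (rule extensible_rep_check[
    where as = "[5, 2, 1, 4, 3, 0, 11, 8, 7, 10, 9, 6, 17, 14, 13, 16, 15, 12, 23, 20, 19, 22,
          21, 18, 29, 26, 25, 28, 27, 24, 31, 30]"
      and bs = "[1, 0, 3, 2, 5, 4, 7, 6, 9, 8, 11, 10, 13, 12, 15, 14, 17, 16, 19, 18, 21, 20,
          23, 22, 25, 24, 27, 26, 29, 28, 31, 30]"
      and cs = "[28, 3, 4, 1, 2, 27, 30, 17, 12, 18, 23, 31, 8, 29, 24, 26, 25, 7, 9, 22, 21, 20,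
          19, 10, 14, 16, 15, 5, 0, 13, 6, 11]"
      and P = "[31, 10, 22, 18, 8, 13, 28, 1, 2, 5, 26, 14, 25, 17, 6]"
      and Q = "[30, 7, 16, 24, 15, 27, 4, 3, 0, 29, 12, 9, 19, 23, 11]"
      and R = "[31, 7, 13, 25, 14, 28, 4, 0, 26, 17, 9, 22, 21, 18, 11]"
      and S = "[30, 10, 19, 20, 23, 8, 16, 27, 1, 5, 29, 15, 24, 12, 6]"
      and y = 30 and z = 31])
    code_simp+

section \<open>Degrees reached from the explicit examples\<close>

lemma extensible_rep_add: "extensible_rep d \<Longrightarrow> extensible_rep (d + 4 * k)"
proof (induction k)
  case (Suc k)
  then show ?case using extensible_rep_add4[of "d + 4 * k"] by (simp add: algebra_simps)
qed simp

lemma order_rep_exists: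
  assumes "5 \<le> d" "d \<noteq> 7"
  shows "order_rep d"
proof (cases "d = 5 \<or> d = 11")
  case True
  then show ?thesis using order_rep_5 order_rep_11 by auto
next
  case False
  \<comment> \<open>The numbers 6, 8, 9 and 15 represent all residues modulo 4. From 5 on, the
    smaller numbers in these classes are 5, 7 and 11.\<close>
  with assms have "(\<exists>k. d = 6 + 4 * k) \<or> (\<exists>k. d = 8 + 4 * k) \<or> (\<exists>k. d = 9 + 4 * k) \<or> (\<exists>k. d = 15 + 4 * k)"
    by presburger
  then show ?thesis
    using extensible_rep_add[OF extensible_rep_6] extensible_rep_add[OF extensible_rep_8]
      extensible_rep_add[OF extensible_rep_9] extensible_rep_add[OF extensible_rep_15]
    by (metis extensible_imp_order_rep)
qed

section \<open>Orders of elements of \<open>H\<^sub>d\<close>\<close>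

lemma H_rels:
  fixes d
  defines "a \<equiv> gen_a d" and "b \<equiv> gen_b d" and "c \<equiv> gen_c d"
  shows "a \<otimes>\<^bsub>Hgrp d\<^esub> a = \<one>\<^bsub>Hgrp d\<^esub>" "b \<otimes>\<^bsub>Hgrp d\<^esub> b = \<one>\<^bsub>Hgrp d\<^esub>" "c \<otimes>\<^bsub>Hgrp d\<^esub> c = \<one>\<^bsub>Hgrp d\<^esub>"
    "(a \<otimes>\<^bsub>Hgrp d\<^esub> b) [^]\<^bsub>Hgrp d\<^esub> (3::nat) = \<one>\<^bsub>Hgrp d\<^esub>"
    "(a \<otimes>\<^bsub>Hgrp d\<^esub> c) [^]\<^bsub>Hgrp d\<^esub> (2::nat) = \<one>\<^bsub>Hgrp d\<^esub>"
    "(b \<otimes>\<^bsub>Hgrp d\<^esub> c) [^]\<^bsub>Hgrp d\<^esub> d = \<one>\<^bsub>Hgrp d\<^esub>"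
    "(b \<otimes>\<^bsub>Hgrp d\<^esub> (a \<otimes>\<^bsub>Hgrp d\<^esub> c)) [^]\<^bsub>Hgrp d\<^esub> d = \<one>\<^bsub>Hgrp d\<^esub>"
proof -
  interpret group "Hgrp d" by (rule group_H)
  note [simp] = gens_in_carrier[of d]
  show "a \<otimes>\<^bsub>Hgrp d\<^esub> a = \<one>\<^bsub>Hgrp d\<^esub>" "b \<otimes>\<^bsub>Hgrp d\<^esub> b = \<one>\<^bsub>Hgrp d\<^esub>" "c \<otimes>\<^bsub>Hgrp d\<^esub> c = \<one>\<^bsub>Hgrp d\<^esub>"
    using H_relator[of "[Gen_a]" 2 d] H_relator[of "[Gen_b]" 2 d] H_relator[of "[Gen_c]" 2 d]
    by (auto simp: relators_def gen_word_def numeral_2_eq_2 assms)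
  show "(a \<otimes>\<^bsub>Hgrp d\<^esub> b) [^]\<^bsub>Hgrp d\<^esub> (3::nat) = \<one>\<^bsub>Hgrp d\<^esub>"
    using H_relator[of "[Gen_a, Gen_b]" 3 d] by (auto simp: relators_def gen_word_def assms)
  show "(a \<otimes>\<^bsub>Hgrp d\<^esub> c) [^]\<^bsub>Hgrp d\<^esub> (2::nat) = \<one>\<^bsub>Hgrp d\<^esub>"
    using H_relator[of "[Gen_a, Gen_c]" 2 d] by (auto simp: relators_def gen_word_def assms)
  show "(b \<otimes>\<^bsub>Hgrp d\<^esub> c) [^]\<^bsub>Hgrp d\<^esub> d = \<one>\<^bsub>Hgrp d\<^esub>"
    using H_relator[of "[Gen_b, Gen_c]" d d] by (auto simp: relators_def gen_word_def assms)
  show "(b \<otimes>\<^bsub>Hgrp d\<^esub> (a \<otimes>\<^bsub>Hgrp d\<^esub> c)) [^]\<^bsub>Hgrp d\<^esub> d = \<one>\<^bsub>Hgrp d\<^esub>"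
    using H_relator[of "[Gen_b, Gen_a, Gen_c]" d d] by (auto simp: relators_def gen_word_def assms)
qed

text \<open>Von Dyck's theorem for \<open>Hgrp d\<close>: the seven equations say that every relator
  evaluates to the identity.\<close>

lemma hom_from_H:
  assumes K: "group K" and car: "x \<in> carrier K" "y \<in> carrier K" "z \<in> carrier K"
    and rel: "x \<otimes>\<^bsub>K\<^esub> x = \<one>\<^bsub>K\<^esub>" "y \<otimes>\<^bsub>K\<^esub> y = \<one>\<^bsub>K\<^esub>" "z \<otimes>\<^bsub>K\<^esub> z = \<one>\<^bsub>K\<^esub>"
      "(x \<otimes>\<^bsub>K\<^esub> y) [^]\<^bsub>K\<^esub> (3::nat) = \<one>\<^bsub>K\<^esub>" "(x \<otimes>\<^bsub>K\<^esub> z) [^]\<^bsub>K\<^esub> (2::nat) = \<one>\<^bsub>K\<^esub>"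
      "(y \<otimes>\<^bsub>K\<^esub> z) [^]\<^bsub>K\<^esub> d = \<one>\<^bsub>K\<^esub>" "(y \<otimes>\<^bsub>K\<^esub> (x \<otimes>\<^bsub>K\<^esub> z)) [^]\<^bsub>K\<^esub> d = \<one>\<^bsub>K\<^esub>"
  obtains h where "h \<in> hom (Hgrp d) K" "h (gen_a d) = x" "h (gen_b d) = y" "h (gen_c d) = z"
proof -
  interpret K: group K by (rule K)
  define f where "f = (\<lambda>g. case g of Gen_a \<Rightarrow> x | Gen_b \<Rightarrow> y | Gen_c \<Rightarrow> z)"
  have f: "range f \<subseteq> carrier K" using car by (auto simp: f_def split: gen.splits)
  have R: "eval_word K f r = \<one>\<^bsub>K\<^esub>" if "r \<in> relators d" for r
    using that unfolding relators_def
    by (auto simp: eval_word_pow[OF K f])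
       (simp_all add: gen_word_def f_def rel car, simp_all add: numeral_2_eq_2 rel car)
  obtain h where "h \<in> hom (presented_group (relators d)) K"
    "\<And>w. h (word_class (relators d) w) = eval_word K f w"
    using K.presented_group_universal[OF f R] by blast
  then show thesis
    using car by (intro that[of h]) (simp_all add: Hgrp_def gen_a_def gen_b_def gen_c_def f_def)
qed

section \<open>The group of all permutations of a set\<close>

lemma BijGroup_mult: "f \<in> Bij F \<Longrightarrow> g \<in> Bij F \<Longrightarrow> f \<otimes>\<^bsub>BijGroup F\<^esub> g = compose F f g"
  by (simp add: BijGroup_def)

lemma BijGroup_carrier: "carrier (BijGroup F) = Bij F"
  by (simp add: BijGroup_def)

lemma BijGroup_one: "\<one>\<^bsub>BijGroup F\<^esub> = (\<lambda>x\<in>F. x)"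
  by (simp add: BijGroup_def)

lemma BijGroup_pow_apply:
  assumes "f \<in> Bij F" "x \<in> F"
  shows "(f [^]\<^bsub>BijGroup F\<^esub> (k::nat)) x = (f ^^ k) x"
  using assms(2)
proof (induction k arbitrary: x)
  case 0
  then show ?case by (simp add: BijGroup_one)
next
  case (Suc k)
  interpret group "BijGroup F" by (rule group_BijGroup)
  have "f [^]\<^bsub>BijGroup F\<^esub> k \<in> Bij F"
    using nat_pow_closed[of f k] assms(1) by (simp add: BijGroup_carrier)
  moreover have "f x \<in> F" using assms(1) Suc.prems Bij_imp_funcset by auto
  ultimately show ?case
    using Suc assms(1) by (simp add: BijGroup_mult compose_eq funpow_swap1)
qed

lemma BijGroup_eq_one_iff:
  assumes "f \<in> Bij F"
  shows "f = \<one>\<^bsub>BijGroup F\<^esub> \<longleftrightarrow> (\<forall>x\<in>F. f x = x)"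
proof
  assume "\<forall>x\<in>F. f x = x"
  then show "f = \<one>\<^bsub>BijGroup F\<^esub>"
    unfolding BijGroup_one
    by (intro extensionalityI[of f F]) (use assms in \<open>auto simp: Bij_def\<close>)
qed (auto simp: BijGroup_one)

lemma BijGroup_pow_eq_one_iff:
  assumes "f \<in> Bij F"
  shows "f [^]\<^bsub>BijGroup F\<^esub> (k::nat) = \<one>\<^bsub>BijGroup F\<^esub> \<longleftrightarrow> (\<forall>x\<in>F. (f ^^ k) x = x)"
proof -
  interpret group "BijGroup F" by (rule group_BijGroup)
  have "f [^]\<^bsub>BijGroup F\<^esub> k \<in> Bij F"
    using nat_pow_closed[of f k] assms by (simp add: BijGroup_carrier)
  then show ?thesis
    using BijGroup_eq_one_iff BijGroup_pow_apply[OF assms] by metis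
qed

text \<open>The relator shows that the order divides \<open>d\<close>. Conversely the permutations
  from \<open>order_rep_exists\<close> define a homomorphism into \<open>BijGroup UNIV\<close>; if
  \<open>(bc)^k = 1\<close>, then \<open>k\<close> steps of the permutation \<open>bc\<close> return
  \<open>x\<close> to itself, and \<open>x\<close> lies on a cycle of length
  \<open>d\<close>.\<close>

lemma ord_bc:
  assumes "5 \<le> d" "d \<noteq> 7"
  shows "group.ord (Hgrp d) (gen_b d \<otimes>\<^bsub>Hgrp d\<^esub> gen_c d) = d"
proof -
  interpret H: group "Hgrp d" by (rule group_H)
  note [simp] = gens_in_carrier[of d]
  let ?bc = "gen_b d \<otimes>\<^bsub>Hgrp d\<^esub> gen_c d"
  obtain n a b c x x' y y' u u' v v' where rep: "triangle_rep n a b c"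
    and T: "two_cycles n d (\<lambda>x. b (c x)) x x' y y'"
    and F: "two_cycles n d (\<lambda>x. b (a (c x))) u u' v v'"
    using order_rep_exists[OF assms] unfolding order_rep_def by blast
  have inv: "a (a w) = w" "b (b w) = w" "c (c w) = w" "a (b (a w)) = b (a (b w))" "a (c w) = c (a w)" for w
    using rep unfolding triangle_rep_def by auto
  have bij: "a \<in> Bij UNIV" "b \<in> Bij UNIV" "c \<in> Bij UNIV"
    using inv by (auto simp: Bij_def intro: involuntory_imp_bij)
  have compose_UNIV: "compose UNIV f g = (\<lambda>w. f (g w))" for f g :: "nat \<Rightarrow> nat"
    by (auto simp: compose_def)
  note comp_Bij = compose_Bij[of _ "UNIV :: nat set", unfolded compose_UNIV]
  obtain h where h: "h \<in> hom (Hgrp d) (BijGroup UNIV)" "h (gen_a d) = a" "h (gen_b d) = b" "h (gen_c d) = c"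
  proof (rule hom_from_H[OF group_BijGroup[of UNIV], of a b c d])
    show "(b \<otimes>\<^bsub>BijGroup UNIV\<^esub> c) [^]\<^bsub>BijGroup UNIV\<^esub> d = \<one>\<^bsub>BijGroup UNIV\<^esub>"
      using two_cycles_funpow[OF T] comp_Bij[OF bij(2,3)]
      by (simp add: BijGroup_mult bij BijGroup_pow_eq_one_iff compose_UNIV)
    show "(b \<otimes>\<^bsub>BijGroup UNIV\<^esub> (a \<otimes>\<^bsub>BijGroup UNIV\<^esub> c)) [^]\<^bsub>BijGroup UNIV\<^esub> d = \<one>\<^bsub>BijGroup UNIV\<^esub>"
      using two_cycles_funpow[OF F] comp_Bij[OF bij(2) comp_Bij[OF bij(1,3)]] comp_Bij[OF bij(1,3)]
      by (simp add: BijGroup_mult bij BijGroup_pow_eq_one_iff compose_UNIV)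
    have "a (b (a (b (a (b w))))) = w" for w
      using inv by metis
    then show "(a \<otimes>\<^bsub>BijGroup UNIV\<^esub> b) [^]\<^bsub>BijGroup UNIV\<^esub> (3::nat) = \<one>\<^bsub>BijGroup UNIV\<^esub>"
      using comp_Bij[OF bij(1,2)]
      by (simp add: BijGroup_mult bij BijGroup_pow_eq_one_iff compose_UNIV) (simp add: numeral_3_eq_3)
    show "(a \<otimes>\<^bsub>BijGroup UNIV\<^esub> c) [^]\<^bsub>BijGroup UNIV\<^esub> (2::nat) = \<one>\<^bsub>BijGroup UNIV\<^esub>"
      using comp_Bij[OF bij(1,3)]
      by (simp add: BijGroup_mult bij BijGroup_pow_eq_one_iff compose_UNIV) (simp add: numeral_2_eq_2 inv)
  qed (use bij inv in \<open>auto simp: BijGroup_carrier BijGroup_mult BijGroup_one compose_UNIV\<close>)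
  interpret h: group_hom "Hgrp d" "BijGroup UNIV" h
    by (intro group_hom.intro group_hom_axioms.intro group_H group_BijGroup h)
  have "d dvd k" if "?bc [^]\<^bsub>Hgrp d\<^esub> k = \<one>\<^bsub>Hgrp d\<^esub>" for k :: nat
  proof -
    have "h ?bc [^]\<^bsub>BijGroup UNIV\<^esub> k = \<one>\<^bsub>BijGroup UNIV\<^esub>"
      using that h.hom_nat_pow[of ?bc k] by simp
    then have "((\<lambda>w. b (c w)) ^^ k) x = x"
      using comp_Bij[OF bij(2,3)]
      by (simp add: h BijGroup_mult bij BijGroup_pow_eq_one_iff compose_UNIV)
    then show ?thesis by (rule two_cycles_period[OF T])
  qed
  then show ?thesis
    using H_rels(6)[of d] H.pow_eq_id[of ?bc] by (auto intro: dvd_antisym)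
qed

text \<open>The generators are their own inverses, so every element is a product of generators and
  the induction has no case for inverses.\<close>

lemma H_induct [consumes 1, case_names one gen]:
  assumes "g \<in> carrier (Hgrp d)" and one: "P \<one>\<^bsub>Hgrp d\<^esub>"
    and gen: "\<And>x g. g \<in> carrier (Hgrp d) \<Longrightarrow> P g \<Longrightarrow> P (gen_class d x \<otimes>\<^bsub>Hgrp d\<^esub> g)"
  shows "P g"
proof -
  interpret group "Hgrp d" by (rule group_H)
  have range: "range (gen_class d) \<subseteq> carrier (Hgrp d)" by (auto simp: gen_class_closed)
  have inv: "inv\<^bsub>Hgrp d\<^esub> gen_class d x = gen_class d x" for x
  proof (rule inv_equality)
    show "gen_class d x \<otimes>\<^bsub>Hgrp d\<^esub> gen_class d x = \<one>\<^bsub>Hgrp d\<^esub>"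
      by (cases x) (simp_all add: H_rels)
  qed (rule gen_class_closed)+
  have "P (eval_word (Hgrp d) (gen_class d) w)" for w
  proof (induction w)
    case (Cons l w)
    then show ?case
      using gen[OF eval_word_closed[OF range]] by (cases l) (simp add: inv)
  qed (simp add: one)
  moreover obtain w where "g = word_class (relators d) w"
    using assms(1) by (auto simp: Hgrp_def presented_group_carrier)
  ultimately show ?thesis by (simp flip: eval_word_gen_class)
qed

text \<open>\<open>(ab)^3 = 1\<close> makes \<open>aba\<close> the inverse of \<open>bab\<close>,
  and \<open>bab\<close> is an involution.\<close>

lemma braid_H:
  "gen_b d \<otimes>\<^bsub>Hgrp d\<^esub> (gen_a d \<otimes>\<^bsub>Hgrp d\<^esub> gen_b d) = gen_a d \<otimes>\<^bsub>Hgrp d\<^esub> (gen_b d \<otimes>\<^bsub>Hgrp d\<^esub> gen_a d)"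
proof -
  interpret group "Hgrp d" by (rule group_H)
  note [simp] = gens_in_carrier[of d]
  let ?a = "gen_a d" and ?b = "gen_b d"
  have "?a \<otimes>\<^bsub>Hgrp d\<^esub> (?b \<otimes>\<^bsub>Hgrp d\<^esub> ?a) \<otimes>\<^bsub>Hgrp d\<^esub> (?b \<otimes>\<^bsub>Hgrp d\<^esub> (?a \<otimes>\<^bsub>Hgrp d\<^esub> ?b)) = \<one>\<^bsub>Hgrp d\<^esub>"
    using H_rels(4)[of d] by (simp add: numeral_3_eq_3 m_assoc)
  then have "?a \<otimes>\<^bsub>Hgrp d\<^esub> (?b \<otimes>\<^bsub>Hgrp d\<^esub> ?a) = inv\<^bsub>Hgrp d\<^esub> (?b \<otimes>\<^bsub>Hgrp d\<^esub> (?a \<otimes>\<^bsub>Hgrp d\<^esub> ?b))"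
    by (intro inv_equality[symmetric]) auto
  moreover have "(?b \<otimes>\<^bsub>Hgrp d\<^esub> (?a \<otimes>\<^bsub>Hgrp d\<^esub> ?b)) \<otimes>\<^bsub>Hgrp d\<^esub> (?b \<otimes>\<^bsub>Hgrp d\<^esub> (?a \<otimes>\<^bsub>Hgrp d\<^esub> ?b)) = \<one>\<^bsub>Hgrp d\<^esub>"
  proof -
    have "?b \<otimes>\<^bsub>Hgrp d\<^esub> (?b \<otimes>\<^bsub>Hgrp d\<^esub> x) = x" "?a \<otimes>\<^bsub>Hgrp d\<^esub> (?a \<otimes>\<^bsub>Hgrp d\<^esub> x) = x"
      if "x \<in> carrier (Hgrp d)" for x
      using that by (simp_all add: m_assoc[symmetric] H_rels)
    then show ?thesis by (simp add: m_assoc H_rels)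
  qed
  ultimately show ?thesis by (metis inv_equality gens_in_carrier(1,2) m_closed)
qed

text \<open>Any collapse would push the order of \<open>bc\<close> below 5: if \<open>c = 1\<close>
  then \<open>bc = b\<close>; if \<open>a = 1\<close> the braid relation gives \<open>b = 1\<close>
  and \<open>bc = c\<close>; if \<open>ab = 1\<close> then \<open>bc = ac\<close> has trivial
  square; if \<open>ac = 1\<close> then \<open>bc = ba\<close> is the inverse of \<open>ab\<close>
  and has trivial cube. The orders 3 and 2 then follow because these numbers are prime.\<close>

lemma ord_H:
  assumes d: "5 \<le> d" "d \<noteq> 7"
  shows "gen_a d \<noteq> \<one>\<^bsub>Hgrp d\<^esub>" "gen_c d \<noteq> \<one>\<^bsub>Hgrp d\<^esub>"
    "group.ord (Hgrp d) (gen_a d \<otimes>\<^bsub>Hgrp d\<^esub> gen_b d) = 3"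
    "group.ord (Hgrp d) (gen_a d \<otimes>\<^bsub>Hgrp d\<^esub> gen_c d) = 2"
proof -
  interpret group "Hgrp d" by (rule group_H)
  note [simp] = gens_in_carrier[of d] and rels = H_rels[of d]
  let ?a = "gen_a d" and ?b = "gen_b d" and ?c = "gen_c d"
  have pow: "(?b \<otimes>\<^bsub>Hgrp d\<^esub> ?c) [^]\<^bsub>Hgrp d\<^esub> k \<noteq> \<one>\<^bsub>Hgrp d\<^esub>" if "0 < k" "k < 5" for k :: nat
    using pow_eq_id[of "?b \<otimes>\<^bsub>Hgrp d\<^esub> ?c" k] ord_bc[OF d] that d by (auto dest: dvd_imp_le)
  have dvd23: "k dvd 2 \<longleftrightarrow> k = 1 \<or> k = 2" "k dvd 3 \<longleftrightarrow> k = 1 \<or> k = 3" for k :: nat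
    using dvd_imp_le[of k 2] dvd_imp_le[of k 3] by (auto simp: le_Suc_eq numeral_2_eq_2 numeral_3_eq_3) presburger
  show "?c \<noteq> \<one>\<^bsub>Hgrp d\<^esub>"
    using pow[of 2] rels(2) by (auto simp: numeral_2_eq_2)
  show "?a \<noteq> \<one>\<^bsub>Hgrp d\<^esub>"
  proof
    assume "?a = \<one>\<^bsub>Hgrp d\<^esub>"
    then have "?b = \<one>\<^bsub>Hgrp d\<^esub>" using braid_H[of d] rels(2) by simp
    then show False using pow[of 2] rels(3) by (auto simp: numeral_2_eq_2)
  qed
  have "?a \<otimes>\<^bsub>Hgrp d\<^esub> ?b \<noteq> \<one>\<^bsub>Hgrp d\<^esub>"
  proof
    assume "?a \<otimes>\<^bsub>Hgrp d\<^esub> ?b = \<one>\<^bsub>Hgrp d\<^esub>"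
    then have "?a \<otimes>\<^bsub>Hgrp d\<^esub> ?b = ?a \<otimes>\<^bsub>Hgrp d\<^esub> ?a" using rels(1) by simp
    then have "?b = ?a" by simp
    then show False using pow[of 2] rels(5) by simp
  qed
  moreover have "ord (?a \<otimes>\<^bsub>Hgrp d\<^esub> ?b) dvd 3"
    using rels(4) pow_eq_id[of "?a \<otimes>\<^bsub>Hgrp d\<^esub> ?b" 3] by simp
  ultimately show "ord (?a \<otimes>\<^bsub>Hgrp d\<^esub> ?b) = 3"
    using ord_eq_1[of "?a \<otimes>\<^bsub>Hgrp d\<^esub> ?b"] dvd23(2) by simp
  have "?a \<otimes>\<^bsub>Hgrp d\<^esub> ?c \<noteq> \<one>\<^bsub>Hgrp d\<^esub>"
  proof
    assume "?a \<otimes>\<^bsub>Hgrp d\<^esub> ?c = \<one>\<^bsub>Hgrp d\<^esub>"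
    then have "?a \<otimes>\<^bsub>Hgrp d\<^esub> ?c = ?a \<otimes>\<^bsub>Hgrp d\<^esub> ?a" using rels(1) by simp
    then have "?c = ?a" by simp
    moreover have "?b \<otimes>\<^bsub>Hgrp d\<^esub> ?a = inv\<^bsub>Hgrp d\<^esub> (?a \<otimes>\<^bsub>Hgrp d\<^esub> ?b)"
      using rels(1,2) by (metis gens_in_carrier(1,2) inv_equality inv_mult_group)
    ultimately show False using pow[of 3] rels(4) by (simp add: nat_pow_inv)
  qed
  moreover have "ord (?a \<otimes>\<^bsub>Hgrp d\<^esub> ?c) dvd 2"
    using rels(5) pow_eq_id[of "?a \<otimes>\<^bsub>Hgrp d\<^esub> ?c" 2] by simp
  ultimately show "ord (?a \<otimes>\<^bsub>Hgrp d\<^esub> ?c) = 2"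
    using ord_eq_1[of "?a \<otimes>\<^bsub>Hgrp d\<^esub> ?c"] dvd23(1) by simp
qed

section \<open>Transitive actions\<close>

lemma sharp_props:
  "sharp d \<in> hom (Hgrp d) (Hgrp d)" "bij_betw (sharp d) (carrier (Hgrp d)) (carrier (Hgrp d))"
  "sharp d (gen_a d) = gen_a d" "sharp d (gen_b d) = gen_b d"
  "sharp d (gen_c d) = gen_a d \<otimes>\<^bsub>Hgrp d\<^esub> gen_c d"
  using theI'[OF sharp_ex1[of d], folded sharp_def] by (auto simp: auto_def Bij_def)

text \<open>Together with \<open>surface_isomorphicE\<close> this trades the conjugation equations
  for intertwining equations free of the inverse of \<open>\<phi>\<close>.\<close>

lemma surface_isomorphicI:
  assumes "bij_betw \<phi> F G" "\<And>x. x \<in> F \<Longrightarrow> \<phi> (\<alpha> x) = \<rho> (\<phi> x)"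
    "\<And>x. x \<in> F \<Longrightarrow> \<phi> (\<beta> x) = \<sigma> (\<phi> x)" "\<And>x. x \<in> F \<Longrightarrow> \<phi> (\<gamma> x) = \<tau> (\<phi> x)"
  shows "surface_isomorphic (F, \<alpha>, \<beta>, \<gamma>) (G, \<rho>, \<sigma>, \<tau>)"
proof -
  have "inv_into F \<phi> y \<in> F" "\<phi> (inv_into F \<phi> y) = y" if "y \<in> G" for y
    using that assms(1) by (auto simp: bij_betw_def inv_into_into f_inv_into_f)
  then show ?thesis
    using assms by (auto intro!: exI[of _ \<phi>])
qed

lemma surface_isomorphicE:
  assumes "surface_isomorphic (F, \<alpha>, \<beta>, \<gamma>) (G, \<rho>, \<sigma>, \<tau>)"
  obtains \<phi> where "bij_betw \<phi> F G" "\<And>x. x \<in> F \<Longrightarrow> \<phi> (\<alpha> x) = \<rho> (\<phi> x)"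
    "\<And>x. x \<in> F \<Longrightarrow> \<phi> (\<beta> x) = \<sigma> (\<phi> x)" "\<And>x. x \<in> F \<Longrightarrow> \<phi> (\<gamma> x) = \<tau> (\<phi> x)"
proof -
  obtain \<phi> where \<phi>: "bij_betw \<phi> F G" "\<forall>y\<in>G. \<phi> (\<alpha> (inv_into F \<phi> y)) = \<rho> y"
      "\<forall>y\<in>G. \<phi> (\<beta> (inv_into F \<phi> y)) = \<sigma> y" "\<forall>y\<in>G. \<phi> (\<gamma> (inv_into F \<phi> y)) = \<tau> y"
    using assms by auto
  have "\<phi> x \<in> G" "inv_into F \<phi> (\<phi> x) = x" if "x \<in> F" for x
    using that \<phi>(1) by (auto simp: bij_betw_def)
  then show thesis using \<phi> by (intro that[of \<phi>]) (auto, metis+)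
qed

text \<open>The map sends \<open>\<rho> g f0\<close> to \<open>\<sigma> g e0\<close>. Equality of
  the two stabilizers makes it well defined and injective; transitivity on \<open>E\<close> makes it
  surjective.\<close>

lemma equivariant_bij:
  assumes F: "group_action G F \<rho>" and E: "group_action G E \<sigma>"
    and f0: "f0 \<in> F" "\<And>f. f \<in> F \<Longrightarrow> \<exists>g\<in>carrier G. \<rho> g f0 = f"
    and e0: "e0 \<in> E" "\<And>e. e \<in> E \<Longrightarrow> \<exists>g\<in>carrier G. \<sigma> g e0 = e"
    and stab: "\<And>g. g \<in> carrier G \<Longrightarrow> \<rho> g f0 = f0 \<longleftrightarrow> \<sigma> g e0 = e0"
  obtains \<phi> where "bij_betw \<phi> F E" "\<And>g f. g \<in> carrier G \<Longrightarrow> f \<in> F \<Longrightarrow> \<phi> (\<rho> g f) = \<sigma> g (\<phi> f)"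
proof -
  interpret F: group_action G F \<rho> by (rule F)
  interpret E: group_action G E \<sigma> by (rule E)
  interpret group G using F.group_hom group_hom.axioms(1) by auto
  \<comment> \<open>Each side says that \<open>h^-1 g\<close> fixes the base point, and the
    stabilizers of \<open>f0\<close> and \<open>e0\<close> agree.\<close>
  have same_iff: "\<rho> g f0 = \<rho> h f0 \<longleftrightarrow> \<sigma> g e0 = \<sigma> h e0" if gh: "g \<in> carrier G" "h \<in> carrier G" for g h
  proof -
    have 1: "\<rho> g f0 = \<rho> h f0 \<longleftrightarrow> \<rho> (inv\<^bsub>G\<^esub> h \<otimes>\<^bsub>G\<^esub> g) f0 = f0"
      using gh f0(1) F.composition_rule[of f0 "inv\<^bsub>G\<^esub> h" g] F.orbit_sym_aux[of h f0]
        F.orbit_sym_aux[of "inv\<^bsub>G\<^esub> h" "\<rho> g f0" f0] F.element_image[of g f0]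
      by (metis inv_closed inv_inv)
    have 2: "\<sigma> g e0 = \<sigma> h e0 \<longleftrightarrow> \<sigma> (inv\<^bsub>G\<^esub> h \<otimes>\<^bsub>G\<^esub> g) e0 = e0"
      using gh e0(1) E.composition_rule[of e0 "inv\<^bsub>G\<^esub> h" g] E.orbit_sym_aux[of h e0]
        E.orbit_sym_aux[of "inv\<^bsub>G\<^esub> h" "\<sigma> g e0" e0] E.element_image[of g e0]
      by (metis inv_closed inv_inv)
    show ?thesis using 1 2 stab gh by simp
  qed
  \<comment> \<open>One group element is chosen for each point; by \<open>same_iff\<close> the value
    of \<open>\<phi>\<close> is independent of the choice.\<close>
  define rep where "rep f = (SOME g. g \<in> carrier G \<and> \<rho> g f0 = f)" for f
  have rep: "rep f \<in> carrier G" "\<rho> (rep f) f0 = f" if "f \<in> F" for f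
    using someI_ex[of "\<lambda>g. g \<in> carrier G \<and> \<rho> g f0 = f"] f0(2)[OF that] unfolding rep_def by blast+
  define \<phi> where "\<phi> f = \<sigma> (rep f) e0" for f
  have \<phi>: "\<phi> (\<rho> g f0) = \<sigma> g e0" if "g \<in> carrier G" for g
    unfolding \<phi>_def using same_iff[of "rep (\<rho> g f0)" g] rep that F.element_image f0(1) by metis
  have "bij_betw \<phi> F E"
    unfolding bij_betw_def
  proof
    show "inj_on \<phi> F"
      by (rule inj_onI) (metis \<phi>_def rep same_iff)
    show "\<phi> ` F = E"
    proof
      show "\<phi> ` F \<subseteq> E" using rep(1) E.element_image[OF _ e0(1) HOL.refl] by (auto simp: \<phi>_def)
      show "E \<subseteq> \<phi> ` F"
      proof
        fix e assume "e \<in> E"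
        then obtain g where "g \<in> carrier G" "\<sigma> g e0 = e" using e0(2) by blast
        then show "e \<in> \<phi> ` F"
          using \<phi> F.element_image f0(1) by (metis image_eqI)
      qed
    qed
  qed
  moreover have "\<phi> (\<rho> g f) = \<sigma> g (\<phi> f)" if "g \<in> carrier G" "f \<in> F" for g f
  proof -
    have "\<phi> (\<rho> g f) = \<phi> (\<rho> (g \<otimes>\<^bsub>G\<^esub> rep f) f0)"
      using rep[OF that(2)] that F.composition_rule f0(1) by simp
    also have "\<dots> = \<sigma> g (\<phi> f)"
      using rep[OF that(2)] that \<phi> E.composition_rule e0(1) by (simp add: \<phi>_def)
    finally show ?thesis .
  qed
  ultimately show thesis using that by blast
qed

section \<open>The action on left cosets\<close>

lemma coset_action:
  assumes G: "group G" and V: "subgroup V G"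
  shows "group_action G (lcosets\<^bsub>G\<^esub> V) (\<lambda>g. \<lambda>C\<in>lcosets\<^bsub>G\<^esub> V. g <#\<^bsub>G\<^esub> C)"
proof -
  interpret group G by (rule G)
  interpret V: subgroup V G by (rule V)
  let ?F = "lcosets\<^bsub>G\<^esub> V" and ?\<rho> = "\<lambda>g. \<lambda>C\<in>lcosets\<^bsub>G\<^esub> V. g <#\<^bsub>G\<^esub> C"
  have sub: "C \<subseteq> carrier G" if "C \<in> ?F" for C
    using V.lcosets_carrier[OF G that] .
  have closed: "g <#\<^bsub>G\<^esub> C \<in> ?F" if "g \<in> carrier G" "C \<in> ?F" for g C
    using that V.subset by (auto simp: LCOSETS_def lcos_m_assoc intro!: bexI[of _ "g \<otimes>\<^bsub>G\<^esub> h" for h])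
  have bij: "?\<rho> g \<in> Bij ?F" if g: "g \<in> carrier G" for g
  proof -
    have "bij_betw (\<lambda>C. g <#\<^bsub>G\<^esub> C) ?F ?F"
      by (rule bij_betw_byWitness[where f' = "\<lambda>C. inv\<^bsub>G\<^esub> g <#\<^bsub>G\<^esub> C"])
         (use g closed sub in \<open>auto simp: lcos_m_assoc lcos_mult_one\<close>)
    then show ?thesis by (auto simp: Bij_def bij_betw_restrict_eq)
  qed
  have "?\<rho> \<in> hom G (BijGroup ?F)"
  proof (rule homI)
    fix g h assume gh: "g \<in> carrier G" "h \<in> carrier G"
    show "?\<rho> (g \<otimes>\<^bsub>G\<^esub> h) = ?\<rho> g \<otimes>\<^bsub>BijGroup ?F\<^esub> ?\<rho> h"
      using gh bij closed sub
      by (auto simp: BijGroup_mult compose_def lcos_m_assoc fun_eq_iff)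
  qed (simp add: BijGroup_carrier bij)
  then show ?thesis
    by (intro group_action.intro group_hom.intro group_hom_axioms.intro G group_BijGroup)
qed

text \<open>The coset \<open>V\<close> serves as base point. Its stabilizer is \<open>V\<close>
  itself, so results about point stabilizers apply to an arbitrary subgroup.\<close>

lemma coset_action_base:
  assumes G: "group G" and V: "subgroup V G"
  defines "\<rho> \<equiv> \<lambda>g. \<lambda>C\<in>lcosets\<^bsub>G\<^esub> V. g <#\<^bsub>G\<^esub> C"
  shows "V \<in> lcosets\<^bsub>G\<^esub> V"
    "C \<in> lcosets\<^bsub>G\<^esub> V \<Longrightarrow> \<exists>g\<in>carrier G. \<rho> g V = C"
    "g \<in> carrier G \<Longrightarrow> \<rho> g V = V \<longleftrightarrow> g \<in> V"
    "stabilizer G \<rho> V = V"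
proof -
  interpret group G by (rule G)
  interpret V: subgroup V G by (rule V)
  show mem: "V \<in> lcosets\<^bsub>G\<^esub> V"
    using lcos_mult_one[OF V.subset] unfolding LCOSETS_def by (metis UN_iff one_closed singletonI)
  show "\<exists>g\<in>carrier G. \<rho> g V = C" if "C \<in> lcosets\<^bsub>G\<^esub> V"
    using that mem by (auto simp: \<rho>_def LCOSETS_def)
  show fix_iff: "\<rho> g V = V \<longleftrightarrow> g \<in> V" if "g \<in> carrier G" for g
    using that lcos_self[OF that V] coset_join3[OF that V] mem by (auto simp: \<rho>_def)
  show "stabilizer G \<rho> V = V"
    using fix_iff V.subset by (auto simp: stabilizer_def)
qed

text \<open>\<open>Orbits.orbit\<close> starts with the first iterate, so it has to be shown that
  \<open>x\<close> recurs: a finite orbit has two equal iterates, and injectivity on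
  \<open>F\<close> cancels them down to \<open>x\<close>. The orbit is then listed without
  repetition up to the first return, which therefore happens after \<open>n\<close> steps.\<close>

lemma funpow_card_orbit:
  assumes f: "f \<in> Bij F" and x: "x \<in> F" and card: "card (Orbits.orbit f x) = n" "0 < n"
  shows "(f ^^ n) x = x"
proof -
  have inj: "inj_on f F" and closed: "\<And>y. y \<in> F \<Longrightarrow> f y \<in> F"
    using f by (auto simp: Bij_def bij_betw_def)
  have pow_closed: "(f ^^ i) x \<in> F" for i
    by (induction i) (auto simp: x closed)
  \<comment> \<open>An infinite set has cardinality 0, so \<open>0 < n\<close> forces
    finiteness.\<close>
  have fin: "finite (Orbits.orbit f x)" using card by (auto intro: card_ge_0_finite)
  have "range (\<lambda>i. (f ^^ Suc i) x) \<subseteq> Orbits.orbit f x"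
    unfolding orbit_altdef by blast
  then have "\<not> inj (\<lambda>i. (f ^^ Suc i) x)"
    using fin by (meson finite_imageD finite_subset infinite_UNIV_nat)
  then obtain i j where "i < j" "(f ^^ Suc i) x = (f ^^ Suc j) x"
    unfolding inj_on_def by (metis linorder_neqE_nat)
  then obtain k where k: "k > 0" "(f ^^ Suc i) x = (f ^^ (k + Suc i)) x"
    by (metis add.commute add_Suc_right less_imp_add_positive)
  have "(f ^^ i) x = (f ^^ (k + i)) x \<Longrightarrow> x = (f ^^ k) x" for i
  proof (induction i)
    case (Suc i)
    then show ?case using inj_onD[OF inj, OF _ pow_closed pow_closed, of i "k + i"] by simp
  qed simp
  from this[OF k(2)] have self: "x \<in> Orbits.orbit f x"
    using k(1) unfolding orbit_altdef by blast
  let ?m = "funpow_dist1 f x x"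
  have "Orbits.orbit f x = (\<lambda>n. (f ^^ n) x) ` {0..<?m}"
    by (rule orbit_conv_funpow_dist1[OF self])
  moreover have "inj_on (\<lambda>n. (f ^^ n) x) {0..<?m}"
    by (rule inj_on_funpow_dist1[OF self])
  ultimately have "?m = n" using card by (simp add: card_image)
  then show ?thesis using funpow_dist1_prop[OF self] by simp
qed

section \<open>Transitive actions of \<open>Hgrp d\<close> with a base flag\<close>

text \<open>This common setting covers the coset quadruples as well as abstract self-dual surfaces;
  the stabilizer of \<open>f0\<close> takes the place of the subgroup in the theorem.\<close>

locale flag_action =
  fixes d :: nat and F :: "'f set" and \<rho> :: "gen word set \<Rightarrow> 'f \<Rightarrow> 'f" and f0 :: 'f
  assumes d: "5 \<le> d" "d \<noteq> 7"
    and action: "group_action (Hgrp d) F \<rho>"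
    and base: "f0 \<in> F"
    and transitive: "\<And>f. f \<in> F \<Longrightarrow> \<exists>g\<in>carrier (Hgrp d). \<rho> g f0 = f"

sublocale flag_action \<subseteq> group "Hgrp d" by (rule group_H)

sublocale flag_action \<subseteq> act: group_action "Hgrp d" F \<rho> by (rule action)

context flag_action
begin

abbreviation "G \<equiv> Hgrp d"
abbreviation "a \<equiv> gen_a d"
abbreviation "b \<equiv> gen_b d"
abbreviation "c \<equiv> gen_c d"
abbreviation "V \<equiv> stabilizer (Hgrp d) \<rho> f0"

lemmas [simp] = gens_in_carrier[of d]

lemma act_closed [simp]: "g \<in> carrier G \<Longrightarrow> f \<in> F \<Longrightarrow> \<rho> g f \<in> F"
  using act.element_image by blast

lemma act_one [simp]: "f \<in> F \<Longrightarrow> \<rho> \<one>\<^bsub>G\<^esub> f = f"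
  by (metis act.id_eq_one restrict_apply')

lemma act_mult:
  "g \<in> carrier G \<Longrightarrow> h \<in> carrier G \<Longrightarrow> f \<in> F \<Longrightarrow> \<rho> (g \<otimes>\<^bsub>G\<^esub> h) f = \<rho> g (\<rho> h f)"
  by (simp add: act.composition_rule)

lemma act_eq_iff:
  assumes "g \<in> carrier G" "f \<in> F" "f' \<in> F"
  shows "\<rho> g f = f' \<longleftrightarrow> f = \<rho> (inv\<^bsub>G\<^esub> g) f'"
  using assms by (metis act_mult act_one inv_closed l_inv r_inv)

lemma compose_act:
  assumes "g \<in> carrier G" "h \<in> carrier G"
  shows "compose F (\<rho> g) (\<rho> h) = \<rho> (g \<otimes>\<^bsub>G\<^esub> h)"
  using assms group_hom.hom_mult[OF act.group_hom] by (simp add: act.bij_prop0 BijGroup_mult)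

lemma act_pow: "g \<in> carrier G \<Longrightarrow> f \<in> F \<Longrightarrow> (\<rho> g ^^ k) f = \<rho> (g [^]\<^bsub>G\<^esub> k) f"
  using BijGroup_pow_apply[OF act.bij_prop0, of g f k] group_hom.hom_nat_pow[OF act.group_hom] by simp

section \<open>Condition (1): stabilizers, freeness and cycle lengths\<close>

text \<open>\<open>y\<close> lies in \<open>g^-1 V g\<close> iff \<open>g y g^-1\<close> fixes
  \<open>f0\<close>; so this conjugate is the stabilizer of \<open>g^-1 f0\<close>.\<close>

lemma conj_mem_iff:
  assumes g: "g \<in> carrier G" and y: "y \<in> carrier G"
  shows "y \<in> inv\<^bsub>G\<^esub> g <#\<^bsub>G\<^esub> V #>\<^bsub>G\<^esub> g \<longleftrightarrow> \<rho> y (\<rho> (inv\<^bsub>G\<^esub> g) f0) = \<rho> (inv\<^bsub>G\<^esub> g) f0"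
proof -
  have "y \<in> inv\<^bsub>G\<^esub> g <#\<^bsub>G\<^esub> V #>\<^bsub>G\<^esub> g \<longleftrightarrow> (\<exists>v\<in>V. y = inv\<^bsub>G\<^esub> g \<otimes>\<^bsub>G\<^esub> v \<otimes>\<^bsub>G\<^esub> g)"
    by (auto simp: l_coset_def r_coset_def)
  also have "\<dots> \<longleftrightarrow> g \<otimes>\<^bsub>G\<^esub> y \<otimes>\<^bsub>G\<^esub> inv\<^bsub>G\<^esub> g \<in> V"
  proof
    assume "\<exists>v\<in>V. y = inv\<^bsub>G\<^esub> g \<otimes>\<^bsub>G\<^esub> v \<otimes>\<^bsub>G\<^esub> g"
    then obtain v where v: "v \<in> V" "y = inv\<^bsub>G\<^esub> g \<otimes>\<^bsub>G\<^esub> v \<otimes>\<^bsub>G\<^esub> g" by blast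
    then have "v \<in> carrier G" by (simp add: stabilizer_def)
    then have "g \<otimes>\<^bsub>G\<^esub> y \<otimes>\<^bsub>G\<^esub> inv\<^bsub>G\<^esub> g = v"
      using g v(2) by (metis inv_closed inv_solve_left inv_solve_right m_assoc m_closed)
    then show "g \<otimes>\<^bsub>G\<^esub> y \<otimes>\<^bsub>G\<^esub> inv\<^bsub>G\<^esub> g \<in> V" using v by simp
  next
    assume *: "g \<otimes>\<^bsub>G\<^esub> y \<otimes>\<^bsub>G\<^esub> inv\<^bsub>G\<^esub> g \<in> V"
    have "y = inv\<^bsub>G\<^esub> g \<otimes>\<^bsub>G\<^esub> (g \<otimes>\<^bsub>G\<^esub> y \<otimes>\<^bsub>G\<^esub> inv\<^bsub>G\<^esub> g) \<otimes>\<^bsub>G\<^esub> g"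
      using g y by (metis inv_closed inv_solve_left inv_solve_right m_assoc m_closed)
    with * show "\<exists>v\<in>V. y = inv\<^bsub>G\<^esub> g \<otimes>\<^bsub>G\<^esub> v \<otimes>\<^bsub>G\<^esub> g" by blast
  qed
  also have "\<dots> \<longleftrightarrow> \<rho> g (\<rho> y (\<rho> (inv\<^bsub>G\<^esub> g) f0)) = f0"
    using g y base by (simp add: stabilizer_def act_mult)
  also have "\<dots> \<longleftrightarrow> \<rho> y (\<rho> (inv\<^bsub>G\<^esub> g) f0) = \<rho> (inv\<^bsub>G\<^esub> g) f0"
    using g y base by (simp add: act_eq_iff)
  finally show ?thesis .
qed

text \<open>The cyclic subgroup is taken in \<open>Hgrp d\<close> and not in its image in
  \<open>BijGroup F\<close>; hence orbit lengths can be compared with the order of \<open>x\<close>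
  in \<open>Hgrp d\<close>.\<close>

definition acts_freely :: "gen word set \<Rightarrow> bool" where
  "acts_freely x \<longleftrightarrow> (\<forall>f\<in>F. \<forall>y\<in>generate G {x}. \<rho> y f = f \<longrightarrow> y = \<one>\<^bsub>G\<^esub>)"

lemma conj_meets_generate_iff:
  assumes x: "x \<in> carrier G"
  shows "(\<forall>g\<in>carrier G. (inv\<^bsub>G\<^esub> g <#\<^bsub>G\<^esub> V #>\<^bsub>G\<^esub> g) \<inter> generate G {x} = {\<one>\<^bsub>G\<^esub>}) \<longleftrightarrow> acts_freely x"
proof -
  have gen: "y \<in> carrier G" if "y \<in> generate G {x}" for y
    using generate_in_carrier[of "{x}" y] x that by auto
  have one: "\<one>\<^bsub>G\<^esub> \<in> (inv\<^bsub>G\<^esub> g <#\<^bsub>G\<^esub> V #>\<^bsub>G\<^esub> g) \<inter> generate G {x}" if "g \<in> carrier G" for g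
    using that base by (auto simp: conj_mem_iff generate.one)
  have eq: "(inv\<^bsub>G\<^esub> g <#\<^bsub>G\<^esub> V #>\<^bsub>G\<^esub> g) \<inter> generate G {x} = {\<one>\<^bsub>G\<^esub>} \<longleftrightarrow>
      (\<forall>y\<in>generate G {x}. \<rho> y (\<rho> (inv\<^bsub>G\<^esub> g) f0) = \<rho> (inv\<^bsub>G\<^esub> g) f0 \<longrightarrow> y = \<one>\<^bsub>G\<^esub>)"
    if g: "g \<in> carrier G" for g
    using one[OF g] conj_mem_iff[OF g gen] by blast
  \<comment> \<open>By transitivity \<open>g^-1 f0\<close> runs through all flags, which turns a
    condition on all conjugates of \<open>V\<close> into one on all flags.\<close>
  have "(\<forall>g\<in>carrier G. P (\<rho> (inv\<^bsub>G\<^esub> g) f0)) \<longleftrightarrow> (\<forall>f\<in>F. P f)" for P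
  proof
    assume *: "\<forall>g\<in>carrier G. P (\<rho> (inv\<^bsub>G\<^esub> g) f0)"
    show "\<forall>f\<in>F. P f"
    proof
      fix f assume "f \<in> F"
      then obtain g where "g \<in> carrier G" "\<rho> g f0 = f" using transitive by blast
      then show "P f" using *[rule_format, of "inv\<^bsub>G\<^esub> g"] by simp
    qed
  qed (simp add: base)
  from this[of "\<lambda>f. \<forall>y\<in>generate G {x}. \<rho> y f = f \<longrightarrow> y = \<one>\<^bsub>G\<^esub>"]
  show ?thesis by (simp add: acts_freely_def eq)
qed

lemma meets_trivially_iff:
  "meets_trivially d V \<longleftrightarrow> acts_freely a \<and> acts_freely c \<and> acts_freely (a \<otimes>\<^bsub>G\<^esub> b) \<and>
     acts_freely (a \<otimes>\<^bsub>G\<^esub> c) \<and> acts_freely (b \<otimes>\<^bsub>G\<^esub> c)"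
  unfolding meets_trivially_def
  by (simp add: ball_conj_distrib flip: conj_meets_generate_iff)

text \<open>The cycle through \<open>f\<close> is the image of the cyclic group of order
  \<open>n\<close> under \<open>y -> \<rho> y f\<close>. It has \<open>n\<close> points iff this map
  is injective, that is, iff only the identity fixes \<open>f\<close>.\<close>

lemma only_cycles_iff:
  assumes x: "x \<in> carrier G" and n: "ord x = n" "0 < n"
  shows "only_cycles_of_length F (\<rho> x) n \<longleftrightarrow> acts_freely x"
proof -
  let ?U = "generate G {x}"
  have U: "?U = {x [^]\<^bsub>G\<^esub> k | k. k \<in> (UNIV :: nat set)}"
    using generate_pow_nat[OF x] n by simp
  have gen: "y \<in> carrier G" if "y \<in> ?U" for y
    using generate_in_carrier[of "{x}" y] x that by auto
  interpret U: subgroup ?U G by (rule generate_is_subgroup) (simp add: x)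
  have card_U: "card ?U = n" using generate_pow_card[OF x] n by simp
  then have fin: "finite ?U" using n(2) by (intro card_ge_0_finite) simp
  have orbit: "Orbits.orbit (\<rho> x) f = (\<lambda>y. \<rho> y f) ` ?U" if f: "f \<in> F" for f
  proof -
    have "(\<rho> x ^^ k) f \<in> Orbits.orbit (\<rho> x) f" for k
    proof (cases k)
      case 0
      \<comment> \<open>\<open>Orbits.orbit\<close> uses positive exponents only, so
        \<open>f\<close> itself appears as the \<open>n\<close>-th iterate.\<close>
      have "(\<rho> x ^^ n) f = f" using act_pow[OF x f, of n] pow_ord_eq_1[OF x] n f by simp
      then show ?thesis unfolding orbit_altdef using 0 n(2) by force
    qed (auto simp: orbit_altdef simp del: funpow.simps)
    then have "Orbits.orbit (\<rho> x) f = {(\<rho> x ^^ k) f | k. True}"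
      unfolding orbit_altdef by blast
    then show ?thesis using act_pow[OF x f] by (auto simp: U)
  qed
  have inj: "inj_on (\<lambda>y. \<rho> y f) ?U \<longleftrightarrow> (\<forall>y\<in>?U. \<rho> y f = f \<longrightarrow> y = \<one>\<^bsub>G\<^esub>)" if f: "f \<in> F" for f
  proof
    assume "inj_on (\<lambda>y. \<rho> y f) ?U"
    then show "\<forall>y\<in>?U. \<rho> y f = f \<longrightarrow> y = \<one>\<^bsub>G\<^esub>"
      using f by (auto dest: inj_onD[of _ _ _ "\<one>\<^bsub>G\<^esub>"])
  next
    assume *: "\<forall>y\<in>?U. \<rho> y f = f \<longrightarrow> y = \<one>\<^bsub>G\<^esub>"
    show "inj_on (\<lambda>y. \<rho> y f) ?U"
    proof (rule inj_onI)
      fix y z assume yz: "y \<in> ?U" "z \<in> ?U" "\<rho> y f = \<rho> z f"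
      then have "\<rho> (inv\<^bsub>G\<^esub> z \<otimes>\<^bsub>G\<^esub> y) f = f"
        using gen f act_eq_iff[of z f "\<rho> z f"] by (simp add: act_mult)
      then have "inv\<^bsub>G\<^esub> z \<otimes>\<^bsub>G\<^esub> y = \<one>\<^bsub>G\<^esub>" using * yz by simp
      then show "y = z" using gen yz by (metis inv_closed inv_equality inv_inv)
    qed
  qed
  show ?thesis
    unfolding only_cycles_of_length_def acts_freely_def
  proof (rule ball_cong[OF HOL.refl])
    fix f assume f: "f \<in> F"
    show "card (Orbits.orbit (\<rho> x) f) = n \<longleftrightarrow> (\<forall>y\<in>?U. \<rho> y f = f \<longrightarrow> y = \<one>\<^bsub>G\<^esub>)"
      using inj_on_iff_eq_card[OF fin, of "\<lambda>y. \<rho> y f"] orbit[OF f] inj[OF f] card_U by simp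
  qed
qed

lemma involution_iff:
  assumes x: "x \<in> carrier G" and xx: "x \<otimes>\<^bsub>G\<^esub> x = \<one>\<^bsub>G\<^esub>" and "x \<noteq> \<one>\<^bsub>G\<^esub>"
  shows "fixed_point_free_involution F (\<rho> x) \<longleftrightarrow> acts_freely x"
proof -
  have inv: "inv\<^bsub>G\<^esub> x = x" using inv_equality[OF xx x x] .
  have "y = \<one>\<^bsub>G\<^esub> \<or> y = x" if "y \<in> generate G {x}" for y
    using that by induction (auto simp: inv x xx)
  moreover have "x \<in> generate G {x}" by (rule generate.incl) simp
  ultimately have "acts_freely x \<longleftrightarrow> (\<forall>f\<in>F. \<rho> x f \<noteq> f)"
    unfolding acts_freely_def using assms(3) by metis
  moreover have "\<rho> x (\<rho> x f) = f" if "f \<in> F" for f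
    using act_mult[OF x x that] xx that by simp
  ultimately show ?thesis
    unfolding fixed_point_free_involution_def using act.bij_prop0[OF x] by auto
qed

lemma b_involution:
  assumes "fixed_point_free_involution F (\<rho> a)"
  shows "fixed_point_free_involution F (\<rho> b)"
  unfolding fixed_point_free_involution_def
proof (intro conjI ballI)
  show "\<rho> b \<in> Bij F" by (rule act.bij_prop0) simp
  fix f assume f: "f \<in> F"
  show "\<rho> b (\<rho> b f) = f" using f H_rels(2)[of d] act_mult[of b b f] by simp
  show "\<rho> b f \<noteq> f"
  proof
    assume fix_b: "\<rho> b f = f"
    \<comment> \<open>the braid relation makes \<open>b\<close> conjugate to \<open>a\<close>, moving the fixed point to \<open>b a f\<close>\<close>
    have "\<rho> b (\<rho> a (\<rho> b f)) = \<rho> a (\<rho> b (\<rho> a f))"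
      using arg_cong[OF braid_H[of d], of "\<lambda>g. \<rho> g f"] f by (simp add: act_mult)
    then have "\<rho> a (\<rho> b (\<rho> a f)) = \<rho> b (\<rho> a f)" using fix_b by simp
    then show False
      using assms f unfolding fixed_point_free_involution_def by simp
  qed
qed

lemma act_in_generate:
  assumes "g \<in> carrier G"
  shows "\<rho> g \<in> carrier (subgroup_generated (BijGroup F) {\<rho> a, \<rho> b, \<rho> c})"
proof -
  let ?S = "{\<rho> a, \<rho> b, \<rho> c}"
  interpret act: group_hom "Hgrp d" "BijGroup F" \<rho> by (rule act.group_hom)
  have sub: "?S \<subseteq> carrier (BijGroup F)" by auto
  have "\<rho> g \<in> generate (BijGroup F) ?S"
    using assms
  proof (induction rule: H_induct)
    case one
    show ?case by (simp add: generate.one)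
  next
    case (gen x g)
    have "\<rho> (gen_class d x) \<in> ?S" by (cases x) auto
    then show ?case
      using gen by (simp add: gen_class_closed generate.eng generate.incl)
  qed
  then show ?thesis using sub by (simp add: carrier_subgroup_generated Int_absorb1)
qed

lemma generated_transitive:
  "transitive_action (subgroup_generated (BijGroup F) {\<rho> a, \<rho> b, \<rho> c}) F (\<lambda>g. g)"
proof -
  interpret B: group "BijGroup F" by (rule group_BijGroup)
  let ?K = "subgroup_generated (BijGroup F) {\<rho> a, \<rho> b, \<rho> c}"
  have "(\<lambda>g. g) \<in> hom ?K (BijGroup F)"
    using B.carrier_subgroup_generated_subset[of "{\<rho> a, \<rho> b, \<rho> c}"] by (auto simp: hom_def)
  then have "group_action ?K F (\<lambda>g. g)"
    by (intro group_action.intro group_hom.intro group_hom_axioms.intro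
        B.group_subgroup_generated group_BijGroup)
  moreover have "\<exists>g\<in>carrier ?K. g f = f'" if ff': "f \<in> F" "f' \<in> F" for f f'
  proof -
    obtain g g' where g: "g \<in> carrier G" "\<rho> g f0 = f" "g' \<in> carrier G" "\<rho> g' f0 = f'"
      using transitive ff' by metis
    then have "f0 = \<rho> (inv\<^bsub>G\<^esub> g) f" using act_eq_iff base ff' by simp
    then have "\<rho> (g' \<otimes>\<^bsub>G\<^esub> inv\<^bsub>G\<^esub> g) f = f'" using g ff' by (simp add: act_mult)
    then show ?thesis using act_in_generate[of "g' \<otimes>\<^bsub>G\<^esub> inv\<^bsub>G\<^esub> g"] g by auto
  qed
  ultimately show ?thesis
    by (intro transitive_action.intro transitive_action_axioms.intro)
qed

lemma degree_surface_iff: "degree_surface d (F, \<rho> a, \<rho> b, \<rho> c) \<longleftrightarrow> meets_trivially d V"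
proof -
  note ords = ord_H[OF d] ord_bc[OF d]
  \<comment> \<open>The clause for \<open>b\<close>, absent from condition (1), follows from the
    clause for \<open>a\<close> by \<open>b_involution\<close>.\<close>
  have "degree_surface d (F, \<rho> a, \<rho> b, \<rho> c) \<longleftrightarrow>
      fixed_point_free_involution F (\<rho> a) \<and> fixed_point_free_involution F (\<rho> c) \<and>
      only_cycles_of_length F (\<rho> (a \<otimes>\<^bsub>G\<^esub> b)) 3 \<and> only_cycles_of_length F (\<rho> (a \<otimes>\<^bsub>G\<^esub> c)) 2 \<and>
      only_cycles_of_length F (\<rho> (b \<otimes>\<^bsub>G\<^esub> c)) d"
    using base b_involution generated_transitive d by (auto simp: compose_act)
  also have "\<dots> \<longleftrightarrow> meets_trivially d V"
    using ords d by (simp add: meets_trivially_iff involution_iff only_cycles_iff H_rels)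
  finally show ?thesis .
qed

section \<open>Condition (2): geodesic self-duality and \<open>sharp\<close>\<close>

lemma sharp_closed [simp]: "g \<in> carrier G \<Longrightarrow> sharp d g \<in> carrier G"
  using sharp_props(1) by (auto simp: hom_def)

text \<open>The isomorphism intertwines the action with its twist by \<open>sharp d\<close>, first
  on generators and then everywhere by induction. So \<open>g\<close> fixes \<open>f0\<close> iff
  \<open>sharp d g\<close> fixes \<open>\<phi> f0\<close>, and the image of \<open>V\<close> is the
  stabilizer of \<open>\<phi> f0\<close>.\<close>

lemma geodesic_self_dual_imp_conjugate:
  assumes "geodesic_self_dual (F, \<rho> a, \<rho> b, \<rho> c)"
  shows "conjugate_to_sharp d V"
proof -
  interpret sharp: group_hom "Hgrp d" "Hgrp d" "sharp d"
    by (intro group_hom.intro group_hom_axioms.intro group_H sharp_props)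
  obtain \<phi> where \<phi>: "bij_betw \<phi> F F" "\<And>f. f \<in> F \<Longrightarrow> \<phi> (\<rho> a f) = \<rho> a (\<phi> f)"
      "\<And>f. f \<in> F \<Longrightarrow> \<phi> (\<rho> b f) = \<rho> b (\<phi> f)" "\<And>f. f \<in> F \<Longrightarrow> \<phi> (\<rho> c f) = \<rho> (a \<otimes>\<^bsub>G\<^esub> c) (\<phi> f)"
    using assms unfolding geodesic_self_dual_def geodesic_dual.simps compose_act[OF gens_in_carrier(1,3)]
    by (rule surface_isomorphicE) blast
  have \<phi>_F: "\<phi> f \<in> F" if "f \<in> F" for f using \<phi>(1) that by (auto simp: bij_betw_def)
  have \<phi>_sharp: "\<phi> (\<rho> g f) = \<rho> (sharp d g) (\<phi> f)" if "g \<in> carrier G" "f \<in> F" for g f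
    using that(1)
  proof (induction rule: H_induct)
    case one
    show ?case using that \<phi>_F by simp
  next
    case (gen x g)
    have "\<phi> (\<rho> (gen_class d x) f') = \<rho> (sharp d (gen_class d x)) (\<phi> f')" if "f' \<in> F" for f'
      using \<phi>(2-4) that by (cases x) (simp_all add: sharp_props)
    then show ?case
      using gen that(2) \<phi>_F by (simp add: act_mult gen_class_closed)
  qed
  obtain h where h: "h \<in> carrier G" "\<rho> h f0 = \<phi> f0" using transitive[OF \<phi>_F[OF base]] by blast
  have V_iff: "g \<in> V \<longleftrightarrow> \<rho> (sharp d g) (\<rho> h f0) = \<rho> h f0" if "g \<in> carrier G" for g
    using that \<phi>_sharp[OF that base] inj_onD[OF bij_betw_imp_inj_on[OF \<phi>(1)], of "\<rho> g f0" f0] base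
    by (auto simp: stabilizer_def h(2))
  \<comment> \<open>The conjugating element is \<open>inv h\<close>, because
    \<open>\<phi> f0 = \<rho> h f0\<close>; this explains the double inverse.\<close>
  have "sharp d ` V = inv\<^bsub>G\<^esub> (inv\<^bsub>G\<^esub> h) <#\<^bsub>G\<^esub> V #>\<^bsub>G\<^esub> inv\<^bsub>G\<^esub> h"
  proof (rule Set.set_eqI)
    fix y
    have sub: "inv\<^bsub>G\<^esub> (inv\<^bsub>G\<^esub> h) <#\<^bsub>G\<^esub> V #>\<^bsub>G\<^esub> inv\<^bsub>G\<^esub> h \<subseteq> carrier G"
      using h(1) by (auto simp: l_coset_def r_coset_def stabilizer_def)
    show "y \<in> sharp d ` V \<longleftrightarrow> y \<in> inv\<^bsub>G\<^esub> (inv\<^bsub>G\<^esub> h) <#\<^bsub>G\<^esub> V #>\<^bsub>G\<^esub> inv\<^bsub>G\<^esub> h"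
    proof (cases "y \<in> carrier G")
      case True
      then obtain g where g: "g \<in> carrier G" "y = sharp d g"
        using sharp_props(2)[of d] by (auto simp: bij_betw_def)
      have "y \<in> sharp d ` V \<longleftrightarrow> g \<in> V"
        using g sharp_props(2)[of d] by (auto simp: bij_betw_def stabilizer_def dest: inj_onD)
      then show ?thesis
        using V_iff[OF g(1)] conj_mem_iff[of "inv\<^bsub>G\<^esub> h" y] h(1) g by simp
    next
      case False
      then show ?thesis using sub by (auto simp: stabilizer_def)
    qed
  qed
  then show ?thesis unfolding conjugate_to_sharp_def using h(1) by blast
qed

text \<open>The action is compared with its twist by \<open>sharp d\<close>. The image of
  \<open>V\<close> is the stabilizer of \<open>k^-1 f0\<close>, so in the twisted action this point
  has stabilizer \<open>V\<close>, just as \<open>f0\<close> has in the original one, and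
  \<open>equivariant_bij\<close> yields the isomorphism.\<close>

lemma conjugate_imp_geodesic_self_dual:
  assumes "conjugate_to_sharp d V"
  shows "geodesic_self_dual (F, \<rho> a, \<rho> b, \<rho> c)"
proof -
  interpret sharp: group_hom "Hgrp d" "Hgrp d" "sharp d"
    by (intro group_hom.intro group_hom_axioms.intro group_H sharp_props)
  obtain k where k: "k \<in> carrier G" "sharp d ` V = inv\<^bsub>G\<^esub> k <#\<^bsub>G\<^esub> V #>\<^bsub>G\<^esub> k"
    using assms unfolding conjugate_to_sharp_def by blast
  let ?e = "\<rho> (inv\<^bsub>G\<^esub> k) f0"
  have hom: "(\<lambda>g. \<rho> (sharp d g)) \<in> hom G (BijGroup F)"
    using group_hom.hom_mult[OF act.group_hom] by (auto simp: hom_def BijGroup_carrier act.bij_prop0)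
  have act': "group_action G F (\<lambda>g. \<rho> (sharp d g))"
    by (intro group_action.intro group_hom.intro group_hom_axioms.intro group_H group_BijGroup hom)
  have trans': "\<exists>g\<in>carrier G. \<rho> (sharp d g) ?e = f" if f: "f \<in> F" for f
  proof -
    obtain g where g: "g \<in> carrier G" "\<rho> g f0 = f" using transitive[OF f] by blast
    \<comment> \<open>\<open>gk\<close> moves \<open>k^-1 f0\<close> to \<open>g f0 = f\<close>, and
      surjectivity of \<open>sharp d\<close> provides a preimage of \<open>gk\<close>.\<close>
    then have "g \<otimes>\<^bsub>G\<^esub> k \<in> sharp d ` carrier G"
      using sharp_props(2)[of d] k(1) by (simp add: bij_betw_def)
    then obtain g' where "g' \<in> carrier G" "sharp d g' = g \<otimes>\<^bsub>G\<^esub> k" by auto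
    moreover have "\<rho> (g \<otimes>\<^bsub>G\<^esub> k) ?e = f"
      using g k(1) base by (simp add: m_assoc flip: act_mult)
    ultimately show ?thesis by metis
  qed
  have stab: "\<rho> g f0 = f0 \<longleftrightarrow> \<rho> (sharp d g) ?e = ?e" if g: "g \<in> carrier G" for g
  proof -
    have "\<rho> g f0 = f0 \<longleftrightarrow> sharp d g \<in> sharp d ` V"
      using g sharp_props(2)[of d] by (auto simp: bij_betw_def stabilizer_def dest: inj_onD)
    then show ?thesis using conj_mem_iff[OF k(1), of "sharp d g"] k(2) g by simp
  qed
  have e: "?e \<in> F" using k(1) base by simp
  obtain \<phi> where \<phi>: "bij_betw \<phi> F F"
      "\<And>g f. g \<in> carrier G \<Longrightarrow> f \<in> F \<Longrightarrow> \<phi> (\<rho> g f) = \<rho> (sharp d g) (\<phi> f)"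
    by (rule equivariant_bij[OF action act' base transitive e trans' stab]) (assumption+, rule that)
  then show ?thesis
    unfolding geodesic_self_dual_def geodesic_dual.simps compose_act[OF gens_in_carrier(1,3)]
    by (intro surface_isomorphicI[of \<phi>]) (simp_all add: sharp_props)
qed

lemma self_dual_degree_surface_iff:
  "geodesic_self_dual (F, \<rho> a, \<rho> b, \<rho> c) \<and> degree_surface d (F, \<rho> a, \<rho> b, \<rho> c) \<longleftrightarrow>
     meets_trivially d V \<and> conjugate_to_sharp d V"
  using degree_surface_iff geodesic_self_dual_imp_conjugate conjugate_imp_geodesic_self_dual by blast

text \<open>\<open>F\<close> based at \<open>f0\<close> and the cosets based at \<open>V\<close> are
  transitive with the same stabilizer.\<close>

lemma isomorphic_coset_quadruple:
  "surface_isomorphic (F, \<rho> a, \<rho> b, \<rho> c) (coset_quadruple G V a b c)"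
proof -
  have V: "subgroup V G" using act.stabilizer_subgroup[OF base] .
  let ?\<sigma> = "\<lambda>g. \<lambda>C\<in>lcosets\<^bsub>G\<^esub> V. g <#\<^bsub>G\<^esub> C"
  note coset = coset_action_base[OF group_H V]
  have stab: "\<rho> g f0 = f0 \<longleftrightarrow> ?\<sigma> g V = V" if "g \<in> carrier G" for g
  proof -
    have "\<rho> g f0 = f0 \<longleftrightarrow> g \<in> V" using that by (simp add: stabilizer_def)
    also have "\<dots> \<longleftrightarrow> ?\<sigma> g V = V" using coset(3)[OF that] by (rule HOL.sym)
    finally show ?thesis .
  qed
  obtain \<phi> where "bij_betw \<phi> F (lcosets\<^bsub>G\<^esub> V)"
      "\<And>g f. g \<in> carrier G \<Longrightarrow> f \<in> F \<Longrightarrow> \<phi> (\<rho> g f) = ?\<sigma> g (\<phi> f)"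
    by (rule equivariant_bij[OF action coset_action[OF group_H V] base transitive coset(1,2) stab]) (assumption+, rule that)
  then show ?thesis
    unfolding coset_quadruple_def by (intro surface_isomorphicI[of \<phi>]) simp_all
qed

end

section \<open>From self-dual surfaces to actions of \<open>Hgrp d\<close>\<close>

lemma surface_flag_action:
  assumes d: "5 \<le> d" "d \<noteq> 7" and surf: "degree_surface d (F, \<alpha>, \<beta>, \<gamma>)"
    and dual: "geodesic_self_dual (F, \<alpha>, \<beta>, \<gamma>)"
  obtains \<rho> f0 where "flag_action d F \<rho> f0" "\<rho> (gen_a d) = \<alpha>" "\<rho> (gen_b d) = \<beta>" "\<rho> (gen_c d) = \<gamma>"
proof -
  interpret B: group "BijGroup F" by (rule group_BijGroup)
  have bij: "\<alpha> \<in> Bij F" "\<beta> \<in> Bij F" "\<gamma> \<in> Bij F"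
    and inv: "\<And>x. x \<in> F \<Longrightarrow> \<alpha> (\<alpha> x) = x" "\<And>x. x \<in> F \<Longrightarrow> \<beta> (\<beta> x) = x" "\<And>x. x \<in> F \<Longrightarrow> \<gamma> (\<gamma> x) = x"
    and F: "F \<noteq> {}" and trans: "transitive_action (subgroup_generated (BijGroup F) {\<alpha>, \<beta>, \<gamma>}) F (\<lambda>g. g)"
    and cyc: "only_cycles_of_length F (compose F \<alpha> \<beta>) 3" "only_cycles_of_length F (compose F \<alpha> \<gamma>) 2"
      "only_cycles_of_length F (compose F \<beta> \<gamma>) d"
    using surf by (auto simp: fixed_point_free_involution_def)
  have closed: "\<alpha> x \<in> F" "\<beta> x \<in> F" "\<gamma> x \<in> F" if "x \<in> F" for x
    using bij that by (auto simp: Bij_def bij_betw_def)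
  have pow_one: "f [^]\<^bsub>BijGroup F\<^esub> n = \<one>\<^bsub>BijGroup F\<^esub>"
    if "f \<in> Bij F" "only_cycles_of_length F f n" "0 < n" for f n
    using that funpow_card_orbit[OF that(1)]
    by (auto simp: BijGroup_pow_eq_one_iff only_cycles_of_length_def)
  have sq_one: "f \<otimes>\<^bsub>BijGroup F\<^esub> f = \<one>\<^bsub>BijGroup F\<^esub>" if "f \<in> Bij F" "\<And>x. x \<in> F \<Longrightarrow> f (f x) = x" for f
    using that by (simp add: BijGroup_mult compose_Bij BijGroup_eq_one_iff compose_eq)
  have comp: "compose F \<alpha> \<beta> \<in> Bij F" "compose F \<alpha> \<gamma> \<in> Bij F" "compose F \<beta> \<gamma> \<in> Bij F"
      "compose F \<beta> (compose F \<alpha> \<gamma>) \<in> Bij F"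
    using bij by (auto intro: compose_Bij)
  have bc_pow: "(compose F \<beta> \<gamma> ^^ d) x = x" if "x \<in> F" for x
    using funpow_card_orbit[OF comp(3) that] cyc(3) that d by (auto simp: only_cycles_of_length_def)
  obtain \<phi> where \<phi>: "bij_betw \<phi> F F" "\<And>x. x \<in> F \<Longrightarrow> \<phi> (\<alpha> x) = \<alpha> (\<phi> x)"
      "\<And>x. x \<in> F \<Longrightarrow> \<phi> (\<beta> x) = \<beta> (\<phi> x)" "\<And>x. x \<in> F \<Longrightarrow> \<phi> (\<gamma> x) = compose F \<alpha> \<gamma> (\<phi> x)"
    using dual unfolding geodesic_self_dual_def geodesic_dual.simps by (rule surface_isomorphicE) blast
  have \<phi>_F: "\<phi> x \<in> F" if "x \<in> F" for x using \<phi>(1) that by (auto simp: bij_betw_def)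
  have \<phi>_pow: "\<phi> ((compose F \<beta> \<gamma> ^^ k) x) = (compose F \<beta> (compose F \<alpha> \<gamma>) ^^ k) (\<phi> x) \<and>
      (compose F \<beta> \<gamma> ^^ k) x \<in> F" if "x \<in> F" for k x
  proof (induction k)
    case (Suc k)
    let ?w = "(compose F \<beta> \<gamma> ^^ k) x"
    have w: "?w \<in> F" and pow: "(compose F \<beta> (compose F \<alpha> \<gamma>) ^^ k) (\<phi> x) = \<phi> ?w"
      using Suc by auto
    show ?case by (simp add: pow w compose_eq \<phi> \<phi>_F closed)
  qed (simp add: that)
  \<comment> \<open>Six relators come from the surface itself; this one needs self-duality, since
    \<phi> carries \<beta>\<gamma> to \<beta>\<alpha>\<gamma>.\<close>
  have bac_pow: "(compose F \<beta> (compose F \<alpha> \<gamma>) ^^ d) y = y" if y: "y \<in> F" for y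
  proof -
    obtain x where "x \<in> F" "y = \<phi> x" using \<phi>(1) y by (auto simp: bij_betw_def)
    then show ?thesis using \<phi>_pow[of x d] bc_pow[of x] by simp
  qed
  obtain \<rho> where \<rho>: "\<rho> \<in> hom (Hgrp d) (BijGroup F)" "\<rho> (gen_a d) = \<alpha>" "\<rho> (gen_b d) = \<beta>" "\<rho> (gen_c d) = \<gamma>"
  proof (rule hom_from_H[OF group_BijGroup[of F], of \<alpha> \<beta> \<gamma> d])
    show "(\<beta> \<otimes>\<^bsub>BijGroup F\<^esub> (\<alpha> \<otimes>\<^bsub>BijGroup F\<^esub> \<gamma>)) [^]\<^bsub>BijGroup F\<^esub> d = \<one>\<^bsub>BijGroup F\<^esub>"
      using bij comp bac_pow by (simp add: BijGroup_mult BijGroup_pow_eq_one_iff)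
  qed (use bij comp cyc d inv pow_one sq_one in \<open>simp_all add: BijGroup_carrier BijGroup_mult\<close>)
  interpret \<rho>: group_hom "Hgrp d" "BijGroup F" \<rho>
    by (intro group_hom.intro group_hom_axioms.intro group_H group_BijGroup \<rho>)
  obtain f0 where f0: "f0 \<in> F" using F by blast
  \<comment> \<open>The image of \<rho> is a subgroup containing \<alpha>, \<beta> and \<gamma>, so
    it inherits the transitivity of the group they generate.\<close>
  have "carrier (subgroup_generated (BijGroup F) {\<alpha>, \<beta>, \<gamma>}) \<subseteq> \<rho> ` carrier (Hgrp d)"
    using \<rho>(2-4) gens_in_carrier[of d]
    by (intro B.subgroup_generated_minimal \<rho>.img_is_subgroup) (auto intro!: image_eqI)
  then have "\<exists>g\<in>carrier (Hgrp d). \<rho> g f0 = f" if "f \<in> F" for f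
    using transitive_action.unique_orbit[OF trans f0 that] by auto
  then have "flag_action d F \<rho> f0"
    using d f0 by (intro flag_action.intro group_action.intro \<rho>.group_hom_axioms)
  then show thesis using that \<rho> by blast
qed

theorem theorem7p1:
  fixes d :: nat
  assumes "d \<ge> 5" and "d \<noteq> 7"
  shows "(\<forall>V. subgroup V (Hgrp d) \<longrightarrow>
            ((geodesic_self_dual (coset_quadruple (Hgrp d) V (gen_a d) (gen_b d) (gen_c d)) \<and>
              degree_surface d (coset_quadruple (Hgrp d) V (gen_a d) (gen_b d) (gen_c d)))
             \<longleftrightarrow> meets_trivially d V \<and> conjugate_to_sharp d V)) \<and>
         (\<forall>S :: 'f quadruple. geodesic_self_dual S \<and> degree_surface d S \<longrightarrow>
            (\<exists>V. subgroup V (Hgrp d) \<and> meets_trivially d V \<and> conjugate_to_sharp d V \<and>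
                 surface_isomorphic S
                   (coset_quadruple (Hgrp d) V (gen_a d) (gen_b d) (gen_c d))))"
proof (intro conjI allI impI)
  fix V assume V: "subgroup V (Hgrp d)"
  let ?\<rho> = "\<lambda>g. \<lambda>C\<in>lcosets\<^bsub>Hgrp d\<^esub> V. g <#\<^bsub>Hgrp d\<^esub> C"
  \<comment> \<open>The coset quadruple consists of the generators acting by left multiplication;
    with base point \<open>V\<close> the stabilizer is the given subgroup.\<close>
  interpret flag_action d "lcosets\<^bsub>Hgrp d\<^esub> V" ?\<rho> V
    using assms coset_action_base[OF group_H V]
    by (intro flag_action.intro coset_action[OF group_H V])
  show "geodesic_self_dual (coset_quadruple (Hgrp d) V (gen_a d) (gen_b d) (gen_c d)) \<and>
        degree_surface d (coset_quadruple (Hgrp d) V (gen_a d) (gen_b d) (gen_c d))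
        \<longleftrightarrow> meets_trivially d V \<and> conjugate_to_sharp d V"
    using self_dual_degree_surface_iff
    unfolding coset_quadruple_def coset_action_base(4)[OF group_H V] .
next
  fix S :: "'f quadruple"
  assume S: "geodesic_self_dual S \<and> degree_surface d S"
  obtain F \<alpha> \<beta> \<gamma> where [simp]: "S = (F, \<alpha>, \<beta>, \<gamma>)" by (cases S)
  obtain \<rho> f0 where "flag_action d F \<rho> f0" and [simp]: "\<rho> (gen_a d) = \<alpha>" "\<rho> (gen_b d) = \<beta>" "\<rho> (gen_c d) = \<gamma>"
    using surface_flag_action[OF assms, of F \<alpha> \<beta> \<gamma>] S by auto
  then interpret flag_action d F \<rho> f0 by simp
  \<comment> \<open>The witness is the stabilizer of \<open>f0\<close>.\<close>
  show "\<exists>V. subgroup V (Hgrp d) \<and> meets_trivially d V \<and> conjugate_to_sharp d V \<and>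
      surface_isomorphic S (coset_quadruple (Hgrp d) V (gen_a d) (gen_b d) (gen_c d))"
    using self_dual_degree_surface_iff isomorphic_coset_quadruple S act.stabilizer_subgroup[OF base]
    by auto
qed

end
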